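(* For every $16$-edge-connected bipartite graph $G$, we have $\chi'_{\rm irr}(G) \leq 2$.
   Context: All graphs are finite and simple. A graph is locally irregular if any two adjacent vertices have distinct degrees. $\chi'_{\rm irr}(G)$ denotes the least number of colours in an edge-colouring of $G$ in which, for each colour, the subgraph formed by the edges of that colour is locally irregular (equivalently, the least number of locally irregular subgraphs into which $E(G)$ can be partitioned). *)

theory Defs
  imports Main "HOL-Library.Extended_Nat"
begin

locale finite_simple_graph =
  fixes V :: "'a set" and E :: "'a set set"
  assumes finite_verts: "finite V"
    and edges: "e \<in> E \<Longrightarrow> e \<subseteq> V \<and> card e = 2"

definition connected_graph :: "'a set \<Rightarrow> 'a set set \<Rightarrow> bool" where
  "connected_graph V E \<longleftrightarrow>
     V \<noteq> {} \<and> (\<forall>u\<in>V. \<forall>v\<in>V. (u, v) \<in> {(x, y). {x, y} \<in> E}\<^sup>*)"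

text \<open>
  No lower bound on the number of vertices is imposed, so a single vertex without edges counts
  as \<open>k\<close>-edge-connected for every \<open>k\<close>.  Some authors exclude this case by convention.
\<close>

definition edge_connected :: "nat \<Rightarrow> 'a set \<Rightarrow> 'a set set \<Rightarrow> bool" where
  "edge_connected k V E \<longleftrightarrow>
     (\<forall>F. F \<subseteq> E \<and> card F < k \<longrightarrow> connected_graph V (E - F))"

definition bipartite :: "'a set \<Rightarrow> 'a set set \<Rightarrow> bool" where
  "bipartite V E \<longleftrightarrow>
     (\<exists>A B. A \<union> B = V \<and> A \<inter> B = {} \<and> (\<forall>e\<in>E. \<exists>a\<in>A. \<exists>b\<in>B. e = {a, b}))"

definition vdegree :: "'a set set \<Rightarrow> 'a \<Rightarrow> nat" where
  "vdegree E v = card {e \<in> E. v \<in> e}"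

text \<open>
  Isolated vertices are irrelevant for local irregularity, so a subgraph is given by its set
  of edges.
\<close>

definition locally_irregular :: "'a set set \<Rightarrow> bool" where
  "locally_irregular E \<longleftrightarrow> (\<forall>u v. {u, v} \<in> E \<longrightarrow> vdegree E u \<noteq> vdegree E v)"

definition locally_irregular_colouring :: "'a set set \<Rightarrow> nat \<Rightarrow> ('a set \<Rightarrow> nat) \<Rightarrow> bool" where
  "locally_irregular_colouring E k c \<longleftrightarrow>
     c ` E \<subseteq> {..<k} \<and> (\<forall>i<k. locally_irregular {e \<in> E. c e = i})"

text \<open>
  Some graphs, for instance a single edge, admit no such colouring at all; the infimum in
  \<^typ>\<open>enat\<close> is then \<open>\<infinity>\<close>.
\<close>

definition irr_chromatic_index :: "'a set set \<Rightarrow> enat" where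
  "irr_chromatic_index E = Inf {enat k | k. \<exists>c. locally_irregular_colouring E k c}"

end

theory Submission
  imports Defs
begin

text \<open>
  In a bipartite graph with classes \<open>A\<close> and \<open>B\<close>, orient an edge from \<open>A\<close> to \<open>B\<close> if it lies
  in \<open>H\<close> and from \<open>B\<close> to \<open>A\<close> otherwise.  Prescribing the degrees of \<open>H\<close> modulo 5 then amounts to
  prescribing out-degree minus in-degree modulo 10, which is possible in a 13-edge-connected graph
  by the argument of Lovasz, Thomassen, Wu and Zhang.

  Fix \<open>r\<close>.  Since \<open>{0, 1} + {0, 2, 4}\<close> and \<open>{2, 3, 4} + {1, 3}\<close> both cover all residues modulo 5,
  one can ask that, modulo 5, \<open>H\<close> has degrees in \<open>{0, 1}\<close> on \<open>A\<close> and in \<open>{2, 3, 4}\<close> on \<open>B\<close>, while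
  its complement has degrees in \<open>r + {0, 2, 4}\<close> on \<open>A\<close> and in \<open>r + {1, 3}\<close> on \<open>B\<close>.  Both parts are
  then locally irregular.  The only obstruction is that the two degree sums of \<open>H\<close> must agree
  modulo 5.  A vertex of \<open>A\<close> whose degree is \<open>r\<close> modulo 5 may receive 0 or 1, and as \<open>A\<close> has at
  least 16 vertices, some \<open>r\<close> leaves four such free choices, which is enough to correct the sums.
\<close>

section \<open>Distance to the multiples of an even number\<close>

text \<open>If the net out-degree of a vertex set is congruent to \<open>n\<close> modulo
  \<open>2 * k\<close>, at least this many edges cross its boundary. This is how the quantity enters
  the cut conditions.\<close>

definition circ_norm :: "int \<Rightarrow> int \<Rightarrow> int" where
  "circ_norm k n = min (n mod (2 * k)) ((- n) mod (2 * k))"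

lemma circ_norm_minus [simp]: "circ_norm k (- n) = circ_norm k n"
  by (simp add: circ_norm_def min.commute)

lemma circ_norm_le: "0 < k \<Longrightarrow> circ_norm k (2 * k * z + s) \<le> \<bar>s\<bar>"
proof -
  assume k: "0 < k"
  have "(2 * k * z + s) mod (2 * k) = s mod (2 * k)" by simp
  moreover have "(- (2 * k * z + s)) mod (2 * k) = (- s) mod (2 * k)"
    by (metis mod_minus_eq calculation)
  moreover have "s \<ge> 0 \<Longrightarrow> s mod (2 * k) \<le> s" by (simp add: zmod_le_nonneg_dividend)
  moreover have "s \<le> 0 \<Longrightarrow> (- s) mod (2 * k) \<le> - s" by (simp add: zmod_le_nonneg_dividend)
  ultimately show ?thesis unfolding circ_norm_def by (smt (verit))
qed

text \<open>The remainder \<open>r\<close> is the centred representative if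
  \<open>r \<le> k\<close>, and \<open>r - 2 * k\<close> is otherwise.\<close>

lemma circ_norm_ex:
  assumes "0 < k"
  obtains z s where "n = 2 * k * z + s" "\<bar>s\<bar> = circ_norm k n" "\<bar>s\<bar> \<le> k"
proof -
  define r where "r = n mod (2 * k)"
  have n: "n = 2 * k * (n div (2 * k)) + r" unfolding r_def by simp
  have r: "0 \<le> r" "r < 2 * k" using assms by (auto simp: r_def)
  have m: "(- n) mod (2 * k) = (if r = 0 then 0 else 2 * k - r)"
    unfolding r_def by (simp add: zmod_zminus1_eq_if)
  show ?thesis
  proof (cases "r \<le> k")
    case True
    then have "circ_norm k n = r" using m r unfolding circ_norm_def r_def[symmetric] by auto
    then show ?thesis using that[OF n] r True by simp
  next
    case False
    then have "circ_norm k n = 2 * k - r" using m r unfolding circ_norm_def r_def[symmetric] by auto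
    moreover have "n = 2 * k * (n div (2 * k) + 1) + (r - 2 * k)" using n by (simp add: algebra_simps)
    ultimately show ?thesis using that[of "n div (2 * k) + 1" "r - 2 * k"] r False by simp
  qed
qed

lemma circ_norm_nonneg: "0 < k \<Longrightarrow> 0 \<le> circ_norm k n"
  by (metis abs_ge_zero circ_norm_ex)

lemma circ_norm_le_k: "0 < k \<Longrightarrow> circ_norm k n \<le> k"
  by (metis circ_norm_ex)

text \<open>Two representatives between \<open>- k\<close> and \<open>k\<close> differ by a multiple
  of \<open>2 * k\<close> of absolute value at most \<open>2 * k\<close>, so they agree or are
  \<open>k\<close> and \<open>- k\<close>.\<close>

lemma circ_norm_eq: "0 < k \<Longrightarrow> \<bar>s\<bar> \<le> k \<Longrightarrow> circ_norm k (2 * k * z + s) = \<bar>s\<bar>"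
proof -
  assume k: "0 < k" and s: "\<bar>s\<bar> \<le> k"
  obtain z' s' where *: "2 * k * z + s = 2 * k * z' + s'" "\<bar>s'\<bar> = circ_norm k (2 * k * z + s)" "\<bar>s'\<bar> \<le> k"
    using circ_norm_ex[OF k] by metis
  have "s' - s = 2 * k * (z - z')" using *(1) by (simp add: algebra_simps)
  moreover have "\<bar>s' - s\<bar> \<le> 2 * k" using s * by linarith
  ultimately have "2 * k * \<bar>z - z'\<bar> \<le> 2 * k * 1" using k by (simp add: abs_mult)
  then have "\<bar>z - z'\<bar> \<le> 1" using k mult_le_cancel_left_pos[of "2 * k" "\<bar>z - z'\<bar>" 1] by linarith
  then consider "z - z' = 0" | "z - z' = 1" | "z - z' = -1" by linarith
  then show ?thesis
    using \<open>s' - s = 2 * k * (z - z')\<close> * s by cases auto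
qed

lemma circ_norm_cong: "2 * k dvd a - b \<Longrightarrow> circ_norm k a = circ_norm k b"
  unfolding circ_norm_def
  by (metis mod_eq_dvd_iff mod_minus_cong)

lemma circ_norm_add: "0 < k \<Longrightarrow> circ_norm k (a + b) \<le> circ_norm k a + circ_norm k b"
proof -
  assume k: "0 < k"
  obtain z s where 1: "a = 2 * k * z + s" "\<bar>s\<bar> = circ_norm k a" using circ_norm_ex[OF k] by metis
  obtain y t where 2: "b = 2 * k * y + t" "\<bar>t\<bar> = circ_norm k b" using circ_norm_ex[OF k] by metis
  have "a + b = 2 * k * (z + y) + (s + t)" using 1 2 by (simp add: algebra_simps)
  then have "circ_norm k (a + b) \<le> \<bar>s + t\<bar>" using circ_norm_le[OF k] by metis
  then show ?thesis using 1 2 by linarith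
qed

lemma circ_norm_le_abs: "0 < k \<Longrightarrow> circ_norm k j \<le> \<bar>j\<bar>"
  using circ_norm_le[of k 0 j] by simp

lemma circ_norm_lip: "0 < k \<Longrightarrow> circ_norm k (a + j) \<le> circ_norm k a + \<bar>j\<bar>"
  using circ_norm_add[of k a j] circ_norm_le_abs[of k j] by linarith

text \<open>The modulus \<open>2 * k\<close> is even. Together with the parity of cut degrees this
  turns a strict cut inequality into one with a margin of two.\<close>

lemma circ_norm_even: "0 < k \<Longrightarrow> even (circ_norm k n) \<longleftrightarrow> even n"
proof -
  assume k: "0 < k"
  obtain z s where "n = 2 * k * z + s" "\<bar>s\<bar> = circ_norm k n" using circ_norm_ex[OF k] by metis
  moreover have "even n \<longleftrightarrow> even s" unfolding \<open>n = _\<close> by simp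
  ultimately show ?thesis by (metis dvd_abs_iff)
qed

lemma circ_norm_dir:
  assumes "0 < k" "\<not> 2 * k dvd n"
  shows "circ_norm k (n - 1) = circ_norm k n - 1 \<or> circ_norm k (n + 1) = circ_norm k n - 1"
proof -
  obtain z s where s: "n = 2 * k * z + s" "\<bar>s\<bar> = circ_norm k n" "\<bar>s\<bar> \<le> k" using circ_norm_ex[OF assms(1)] by metis
  have "s \<noteq> 0" using assms(2) s by auto
  then show ?thesis
    using circ_norm_eq[OF assms(1), of "s - 1" z] circ_norm_eq[OF assms(1), of "s + 1" z] s
    by (cases "s > 0") (auto simp: algebra_simps)
qed

text \<open>If a step up does not come closer to a multiple, \<open>n\<close> lies weakly above its
  nearest multiple. At the midpoint \<open>k\<close> both directions come closer, which makes the
  bound strict.\<close>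

lemma circ_norm_pos_rep:
  assumes "0 < k" "circ_norm k (n + 1) \<noteq> circ_norm k n - 1" 
  obtains z where "n = 2 * k * z + circ_norm k n" "circ_norm k n < k"
proof -
  obtain z s where s: "n = 2 * k * z + s" "\<bar>s\<bar> = circ_norm k n" "\<bar>s\<bar> \<le> k" using circ_norm_ex[OF assms(1)] by metis
  have "0 \<le> s"
  proof (rule ccontr)
    assume "\<not> 0 \<le> s"
    then show False using circ_norm_eq[OF assms(1), of "s + 1" z] s assms(2) by (auto simp: algebra_simps)
  qed
  moreover have "s \<noteq> k"
  proof
    assume "s = k"
    then have "n + 1 = 2 * k * (z + 1) + (1 - k)" using s by (simp add: algebra_simps)
    then have "circ_norm k (n + 1) = \<bar>1 - k\<bar>"
      using circ_norm_eq[OF assms(1), of "1 - k" "z + 1"] assms(1) by (simp only: \<open>n + 1 = _\<close>)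
    then have "circ_norm k (n + 1) = k - 1" using assms(1) by simp
    then show False using assms s \<open>s = k\<close> by auto
  qed
  ultimately show ?thesis using that[of z] s by auto
qed

lemma circ_norm_step: "0 < k \<Longrightarrow> circ_norm k (n + 1) = circ_norm k n - 1 \<or> circ_norm k (n + 1) = circ_norm k n + 1"
proof -
  assume k: "0 < k"
  have "circ_norm k (n + 1) \<le> circ_norm k n + 1" using circ_norm_lip[OF k, of n 1] by simp
  moreover have "circ_norm k n \<le> circ_norm k (n + 1) + 1" using circ_norm_lip[OF k, of "n + 1" "-1"] by simp
  moreover have "circ_norm k (n + 1) \<noteq> circ_norm k n" using circ_norm_even[OF k] by (metis even_plus_one_iff)
  ultimately show ?thesis by linarith
qed

text \<open>If a step up comes closer, \<open>n\<close> lies below its nearest multiple or at the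
  midpoint, where \<open>k\<close> and \<open>- k\<close> are congruent.\<close>

lemma circ_norm_neg_rep:
  assumes k: "0 < k" and "circ_norm k (n + 1) = circ_norm k n - 1"
  shows "2 * k dvd n + circ_norm k n"
proof -
  obtain z s where s: "n = 2 * k * z + s" "\<bar>s\<bar> = circ_norm k n" "\<bar>s\<bar> \<le> k" using circ_norm_ex[OF k] by metis
  show ?thesis
  proof (cases "0 \<le> s \<and> s < k")
    case True
    then have "circ_norm k (2 * k * z + (s + 1)) = s + 1" using circ_norm_eq[OF k, of "s + 1" z] by simp
    then show ?thesis using s True assms(2) by (simp add: add.assoc)
  next
    case False
    then have "s = k \<or> s + circ_norm k n = 0" using s by linarith
    then have "n + circ_norm k n = 2 * k * (z + 1) \<or> n + circ_norm k n = 2 * k * z"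
      using s k by (auto simp: algebra_simps)
    then show ?thesis by (metis dvd_triv_left)
  qed
qed

section \<open>Finite sums of integers\<close>

lemma even_sum_symmetric:
  fixes m :: "'v \<Rightarrow> 'v \<Rightarrow> int"
  assumes "finite A" "\<And>u v. m u v = m v u" "\<And>v. m v v = 0"
  shows "even (\<Sum>u\<in>A. \<Sum>v\<in>A. m u v)"
  using assms(1)
proof induction
  case (insert x A)
  have "(\<Sum>u\<in>insert x A. \<Sum>v\<in>insert x A. m u v)
      = (\<Sum>v\<in>A. m x v) + (\<Sum>u\<in>A. m u x) + (\<Sum>u\<in>A. \<Sum>v\<in>A. m u v)"
    using insert assms(3) by (simp add: sum.distrib)
  moreover have "(\<Sum>u\<in>A. m u x) = (\<Sum>u\<in>A. m x u)" using assms(2) by metis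
  ultimately show ?case using insert.IH by simp
qed simp

text \<open>Greedy: \<open>x\<close> takes as much of \<open>s\<close> as its capacity allows. Used
  to share out the arcs of a contracted vertex among the vertices it stands for.\<close>

lemma sum_distribute:
  fixes g :: "'v \<Rightarrow> int"
  assumes "finite A" "\<And>w. 0 \<le> g w" "0 \<le> s" "s \<le> sum g A"
  shows "\<exists>f. (\<forall>w. 0 \<le> f w \<and> f w \<le> g w) \<and> sum f A = s"
  using assms(1,3,4)
proof (induction A arbitrary: s)
  case empty
  then show ?case using assms(2) by (intro exI[of _ "\<lambda>_. 0"]) auto
next
  case (insert x A)
  define t where "t = max 0 (s - g x)"
  have "0 \<le> t" "t \<le> sum g A" using insert sum_nonneg[of A g] assms(2) unfolding t_def by auto
  then obtain f where f: "\<forall>w. 0 \<le> f w \<and> f w \<le> g w" "sum f A = t"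
    using insert.IH[of t] by blast
  have "sum (f(x := s - t)) A = sum f A" using insert.hyps by (intro sum.cong) auto
  then have "sum (f(x := s - t)) (insert x A) = s" using insert.hyps f by simp
  moreover have "0 \<le> s - t" "s - t \<le> g x" unfolding t_def using insert.prems assms(2)[of x] by auto
  ultimately show ?case using f by (intro exI[of _ "f(x := s - t)"]) auto
qed

section \<open>Orientations with prescribed net out-degrees\<close>

definition cut_degree :: "('v \<Rightarrow> 'v \<Rightarrow> int) \<Rightarrow> ('v \<Rightarrow> int) \<Rightarrow> ('v \<Rightarrow> int) \<Rightarrow> 'v set \<Rightarrow> 'v set \<Rightarrow> int" where
  "cut_degree m p q V A = (\<Sum>u\<in>A. \<Sum>v\<in>V - A. m u v) + sum p A + sum q A"

text \<open>\<open>f u v\<close> counts the parallel edges between \<open>u\<close> and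
  \<open>v\<close> that are directed from \<open>u\<close> to \<open>v\<close>.\<close>

definition mod_orientable ::
    "int \<Rightarrow> 'v set \<Rightarrow> ('v \<Rightarrow> 'v \<Rightarrow> int) \<Rightarrow> ('v \<Rightarrow> int) \<Rightarrow> ('v \<Rightarrow> int) \<Rightarrow> ('v \<Rightarrow> int) \<Rightarrow> bool" where
  "mod_orientable k V m b p q \<longleftrightarrow>
     (\<exists>f. (\<forall>u\<in>V. \<forall>v\<in>V. 0 \<le> f u v \<and> f u v + f v u = m u v) \<and>
          (\<forall>v\<in>V. 2 * k dvd (\<Sum>u\<in>V. f v u - f u v) + p v - q v - b v))"

text \<open>
  \<open>m u v\<close> is the multiplicity of the edge \<open>uv\<close>, and \<open>p v\<close> and \<open>q v\<close> count the edges from \<open>v\<close> to, and to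
  \<open>v\<close> from, an additional vertex outside \<open>V\<close> all of whose edges have already been oriented.
  \<open>b v\<close> is the net out-degree modulo \<open>2k\<close> that is demanded at \<open>v\<close>, these edges included.  The set \<open>X\<close>
  is empty or consists of one vertex that is exempt from the degree condition.
\<close>

locale orientation_state =
  fixes k :: int and V :: "'v set" and m :: "'v \<Rightarrow> 'v \<Rightarrow> int" and b p q :: "'v \<Rightarrow> int" and X :: "'v set"
  assumes k2: "2 \<le> k"
    and fin: "finite V"
    and m_nonneg: "0 \<le> m u v" and m_sym: "m u v = m v u" and m_diag: "m v v = 0"
    and p_nonneg: "0 \<le> p v" and q_nonneg: "0 \<le> q v"
    and balance: "2 * k dvd (\<Sum>v\<in>V. b v - p v + q v)"
    and parity: "v \<in> V \<Longrightarrow> even (b v - p v + q v + (\<Sum>u\<in>V. m v u))"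
    and tokens: "sum p V + sum q V \<le> 2 * k - 2 + circ_norm k (sum b V)"
    and exempt: "X = {} \<or> (\<exists>v\<in>V. X = {v} \<and> 2 * k dvd b v)"
    and cuts: "A \<subseteq> V \<Longrightarrow> A \<noteq> {} \<Longrightarrow> A \<noteq> V \<Longrightarrow> A \<noteq> X \<Longrightarrow>
                 2 * k - 2 + circ_norm k (sum b A) \<le> cut_degree m p q V A"
begin

lemma k0: "0 < k" using k2 by simp

lemma finite_sub: "A \<subseteq> V \<Longrightarrow> finite A" using fin finite_subset by blast

text \<open>Summing the vertex parities over \<open>A\<close> counts every edge inside
  \<open>A\<close> twice, so modulo 2 only the edges leaving \<open>A\<close> remain.\<close>

lemma cut_degree_parity:
  assumes "A \<subseteq> V"
  shows "even (cut_degree m p q V A - sum b A)"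
proof -
  have fA: "finite A" using assms finite_sub by blast
  have "even (\<Sum>v\<in>A. b v - p v + q v + (\<Sum>u\<in>V. m v u))"
    using parity assms by (intro dvd_sum) auto
  moreover have "(\<Sum>u\<in>V. m v u) = (\<Sum>u\<in>V - A. m v u) + (\<Sum>u\<in>A. m v u)" for v
    using assms fin by (metis sum.subset_diff)
  ultimately have "even (sum b A - sum p A + sum q A + (\<Sum>v\<in>A. \<Sum>u\<in>V - A. m v u) + (\<Sum>v\<in>A. \<Sum>u\<in>A. m v u))"
    by (simp add: sum.distrib sum_subtractf add.assoc)
  moreover have "even (\<Sum>v\<in>A. \<Sum>u\<in>A. m v u)"
    using even_sum_symmetric[OF fA, of m] m_sym m_diag by blast
  ultimately show ?thesis unfolding cut_degree_def by auto
qed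

end

text \<open>Contraction lowers the number of vertices, deletion and lifting lower the number of
  edges, and absorbing a pre-oriented edge lowers only the last component. Deletion may create
  pre-oriented edges, so they are compared last.\<close>

definition state_size :: "'v set \<Rightarrow> ('v \<Rightarrow> 'v \<Rightarrow> int) \<Rightarrow> ('v \<Rightarrow> int) \<Rightarrow> ('v \<Rightarrow> int) \<Rightarrow> nat \<times> nat \<times> nat" where
  "state_size V m p q = (card V, nat (\<Sum>u\<in>V. \<Sum>v\<in>V. m u v), nat (sum p V + sum q V))"

abbreviation smaller :: "((nat \<times> nat \<times> nat) \<times> (nat \<times> nat \<times> nat)) set" where
  "smaller \<equiv> less_than <*lex*> less_than <*lex*> less_than"

text \<open>With the induction hypothesis as a locale assumption, each reduction becomes a lemma
  about the current state.\<close>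

locale induction_state = orientation_state k V m b p q X
  for k and V :: "'v set" and m b p q X +
  assumes IH: "\<And>(V' :: 'v set) m' b' p' q' X'. orientation_state k V' m' b' p' q' X' \<Longrightarrow>
    (state_size V' m' p' q', state_size V m p q) \<in> smaller \<Longrightarrow> mod_orientable k V' m' b' p' q'"
begin

text \<open>
  A tight set is contracted first; the orientation found for the edges leaving it then makes
  the complement play the role of the pre-oriented vertex.
\<close>

lemma contract:
  assumes A: "A \<subseteq> V" "A \<noteq> V" "2 \<le> card A" "cut_degree m p q V A \<le> 2 * k - 2 + circ_norm k (sum b A)"
  shows "mod_orientable k V m b p q"
proof -
  have fA: "finite A" using A finite_sub by blast
  obtain a where a: "a \<in> A" using A(3) by fastforce
  define U where "U = V - A"
  have fU: "finite U" and UA: "U \<inter> A = {}" "V = U \<union> A" and aU: "a \<notin> U"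
    using fin A a unfolding U_def by auto
  \<comment> \<open>The vertex \<open>a\<close> represents the contracted \<open>A\<close>:
    \<open>ct\<close> collects at \<open>a\<close> the values over \<open>A\<close>, and
    \<open>hat\<close> expands a set of the contracted graph, so that its cuts are the cuts of
    \<open>V\<close> that do not split \<open>A\<close>.\<close>
  define V' where "V' = insert a U"
  define m' where "m' u v = (if u = a then (if v = a then 0 else \<Sum>w\<in>A. m w v)
    else if v = a then \<Sum>w\<in>A. m w u else m u v)" for u v
  define ct where "ct g u = (if u = a then sum g A else g u)" for g :: "'v \<Rightarrow> int" and u
  define hat where "hat B = (if a \<in> B then (B - {a}) \<union> A else B)" for B
  have ct_sum: "sum (ct g) B = sum g (hat B)" if "B \<subseteq> V'" for g B
  proof (cases "a \<in> B")
    case True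
    define B0 where "B0 = B - {a}"
    have B0: "B = insert a B0" "a \<notin> B0" "B0 \<subseteq> U" using True that aU unfolding B0_def V'_def by auto
    have f0: "finite B0" using B0 fU finite_subset by blast
    have "sum (ct g) B0 = sum g B0" using B0 by (intro sum.cong) (auto simp: ct_def)
    moreover have "sum g (B0 \<union> A) = sum g B0 + sum g A" using B0 f0 fA UA by (intro sum.union_disjoint) auto
    ultimately show ?thesis using B0 f0 True unfolding hat_def B0_def[symmetric] by (simp add: ct_def)
  next
    case False
    then show ?thesis unfolding hat_def by (intro sum.cong) (auto simp: ct_def)
  qed
  have dd': "cut_degree m' (ct p) (ct q) V' B = cut_degree m p q V (hat B)" if B: "B \<subseteq> V'" for B
  proof -
    have "(\<Sum>u\<in>B. \<Sum>v\<in>V' - B. m' u v) = (\<Sum>u\<in>hat B. \<Sum>v\<in>V - hat B. m u v)"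
    proof (cases "a \<in> B")
      case True
      define B0 where "B0 = B - {a}"
      have B0: "B = insert a B0" "a \<notin> B0" "B0 \<subseteq> U" using True B aU unfolding B0_def V'_def by auto
      have f0: "finite B0" using B0 fU finite_subset by blast
      have hB: "hat B = B0 \<union> A" using True unfolding hat_def B0_def by simp
      define C where "C = V - hat B"
      have C: "V' - B = C" "a \<notin> C" using B0 UA aU a unfolding C_def hB V'_def by auto
      have "(\<Sum>v\<in>C. m' a v) = (\<Sum>v\<in>C. \<Sum>w\<in>A. m w v)" using C by (intro sum.cong) (auto simp: m'_def)
      also have "\<dots> = (\<Sum>w\<in>A. \<Sum>v\<in>C. m w v)" by (rule sum.swap)
      finally have 1: "(\<Sum>v\<in>C. m' a v) = (\<Sum>w\<in>A. \<Sum>v\<in>C. m w v)" .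
      have 2: "(\<Sum>u\<in>B0. \<Sum>v\<in>C. m' u v) = (\<Sum>u\<in>B0. \<Sum>v\<in>C. m u v)"
        using C B0 by (intro sum.cong) (auto simp: m'_def)
      have 3: "(\<Sum>u\<in>B0 \<union> A. \<Sum>v\<in>C. m u v) = (\<Sum>u\<in>B0. \<Sum>v\<in>C. m u v) + (\<Sum>w\<in>A. \<Sum>v\<in>C. m w v)"
        using B0 f0 fA UA by (intro sum.union_disjoint) auto
      show ?thesis unfolding C(1) C_def[symmetric] unfolding hB 3 using B0 f0 1 2 by simp
    next
      case False
      have BU: "B \<subseteq> U" using B False unfolding V'_def by auto
      have hB: "hat B = B" using False unfolding hat_def by simp
      have "(\<Sum>v\<in>V' - B. m' u v) = (\<Sum>v\<in>V - B. m u v)" if u: "u \<in> B" for u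
      proof -
        have ua: "u \<noteq> a" using u False by auto
        have "V' - B = insert a (U - B)" using False unfolding V'_def by auto
        then have "(\<Sum>v\<in>V' - B. m' u v) = m' u a + (\<Sum>v\<in>U - B. m' u v)" using fU aU by simp
        also have "(\<Sum>v\<in>U - B. m' u v) = (\<Sum>v\<in>U - B. m u v)"
          using ua aU by (intro sum.cong) (auto simp: m'_def)
        also have "m' u a = (\<Sum>v\<in>A. m u v)" using ua m_sym unfolding m'_def by auto
        also have "(\<Sum>v\<in>A. m u v) + (\<Sum>v\<in>U - B. m u v) = (\<Sum>v\<in>V - B. m u v)"
        proof -
        have "V - B = (U - B) \<union> A" using BU UA by auto
        moreover have "(U - B) \<inter> A = {}" using UA(1) by auto
        ultimately have "(\<Sum>v\<in>A. m u v) + (\<Sum>v\<in>U - B. m u v) = (\<Sum>v\<in>V - B. m u v)"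
          using sum.union_disjoint[of "U - B" A "m u"] fU fA by simp
          then show ?thesis .
        qed
        finally show ?thesis .
      qed
      then show ?thesis unfolding hB by simp
    qed
    then show ?thesis unfolding cut_degree_def using ct_sum[OF B] by simp
  qed
  have hatV: "hat V' = V" using UA a aU unfolding hat_def V'_def by auto
  have rowU: "(\<Sum>u\<in>V'. m' v u) = (\<Sum>u\<in>V. m v u)" if "v \<in> U" for v
  proof -
    have va: "v \<noteq> a" using that aU by auto
    have "(\<Sum>u\<in>U. m' v u) = (\<Sum>u\<in>U. m v u)" using va aU by (intro sum.cong) (auto simp: m'_def)
    moreover have "m' v a = (\<Sum>u\<in>A. m v u)" using va m_sym unfolding m'_def by auto
    moreover have "(\<Sum>u\<in>V. m v u) = (\<Sum>u\<in>U. m v u) + (\<Sum>u\<in>A. m v u)"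
      unfolding UA(2) using fU fA UA(1) by (intro sum.union_disjoint) auto
    ultimately show ?thesis unfolding V'_def using fU aU by simp
  qed
  have rowa: "(\<Sum>u\<in>V'. m' a u) = (\<Sum>w\<in>A. \<Sum>u\<in>U. m w u)"
  proof -
    have "(\<Sum>u\<in>V'. m' a u) = (\<Sum>u\<in>U. m' a u)" unfolding V'_def using fU aU by (simp add: m'_def)
    also have "\<dots> = (\<Sum>u\<in>U. \<Sum>w\<in>A. m w u)" using aU by (intro sum.cong) (auto simp: m'_def)
    also have "\<dots> = (\<Sum>w\<in>A. \<Sum>u\<in>U. m w u)" by (rule sum.swap)
    finally show ?thesis .
  qed
  \<comment> \<open>An exempt vertex inside \<open>A\<close> is dropped: as \<open>A\<close> has at
    least two vertices, a set containing \<open>a\<close> never expands to a single vertex.\<close>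
  have S1: "orientation_state k V' m' (ct b) (ct p) (ct q) (X - A)"
  proof
    show "2 \<le> k" by (rule k2)
    show "finite V'" unfolding V'_def using fU by simp
    show "0 \<le> m' u v" for u v unfolding m'_def using m_nonneg by (auto intro: sum_nonneg)
    show "m' u v = m' v u" for u v unfolding m'_def using m_sym by auto
    show "m' v v = 0" for v unfolding m'_def using m_diag by auto
    show "0 \<le> ct p v" for v unfolding ct_def using p_nonneg by (auto intro: sum_nonneg)
    show "0 \<le> ct q v" for v unfolding ct_def using q_nonneg by (auto intro: sum_nonneg)
    show "2 * k dvd (\<Sum>v\<in>V'. ct b v - ct p v + ct q v)"
      using balance by (simp add: sum.distrib sum_subtractf ct_sum hatV)
    show "sum (ct p) V' + sum (ct q) V' \<le> 2 * k - 2 + circ_norm k (sum (ct b) V')"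
      using tokens by (simp add: ct_sum hatV)
    show "even (ct b v - ct p v + ct q v + (\<Sum>u\<in>V'. m' v u))" if "v \<in> V'" for v
    proof (cases "v = a")
      case True
      have "even (cut_degree m p q V A - sum b A)" using cut_degree_parity A by blast
      then show ?thesis unfolding True rowa cut_degree_def U_def[symmetric] by (auto simp: ct_def)
    next
      case False
      then have v: "v \<in> U" using that V'_def by auto
      show ?thesis using parity[of v] False v UA unfolding rowU[OF v] by (auto simp: ct_def)
    qed
    show "X - A = {} \<or> (\<exists>v\<in>V'. X - A = {v} \<and> 2 * k dvd ct b v)"
      using exempt UA a unfolding V'_def ct_def by auto
    fix B assume B: "B \<subseteq> V'" "B \<noteq> {}" "B \<noteq> V'" "B \<noteq> X - A"
    have "hat B \<subseteq> V" using B(1) UA a unfolding hat_def V'_def by auto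
    moreover have "hat B \<noteq> {}" using B(2) a unfolding hat_def by auto
    moreover have "hat B \<noteq> V" using B(1,3) UA a aU unfolding hat_def V'_def by (auto split: if_splits)
    moreover have "hat B \<noteq> X"
    proof
      assume h: "hat B = X"
      show False
      proof (cases "a \<in> B")
        case True
        then have "A \<subseteq> X" using h unfolding hat_def by auto
        then have "card A \<le> card X" using exempt by (intro card_mono) auto
        moreover have "card X \<le> 1" using exempt by auto
        ultimately show False using A(3) by linarith
      next
        case False
        then have "B = X" "B \<inter> A = {}" using h B(1) UA unfolding hat_def V'_def by auto
        then show False using B(4) by auto
      qed
    qed
    ultimately show "2 * k - 2 + circ_norm k (sum (ct b) B) \<le> cut_degree m' (ct p) (ct q) V' B"
      using cuts[of "hat B"] dd'[OF B(1)] ct_sum[OF B(1)] by simp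
  qed
  have "card V = card U + card A" unfolding UA(2) using fU fA UA(1) by (intro card_Un_disjoint) auto
  then have "card V' < card V" unfolding V'_def using fU aU A(3) by simp
  then have "mod_orientable k V' m' (ct b) (ct p) (ct q)" using IH[OF S1] by (simp add: state_size_def)
  then obtain f where f: "\<And>u v. u \<in> V' \<Longrightarrow> v \<in> V' \<Longrightarrow> 0 \<le> f u v \<and> f u v + f v u = m' u v"
    "\<And>v. v \<in> V' \<Longrightarrow> 2 * k dvd (\<Sum>u\<in>V'. f v u - f u v) + ct p v - ct q v - ct b v"
    unfolding mod_orientable_def by blast
  \<comment> \<open>The arcs from \<open>a\<close> to \<open>u\<close> are shared among the vertices
    \<open>w\<close> of \<open>A\<close>, at most \<open>m w u\<close> each. The other edges between
    \<open>A\<close> and \<open>u\<close> point into \<open>A\<close>.\<close>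
  have "\<exists>g. (\<forall>w. 0 \<le> g w \<and> g w \<le> m w u) \<and> sum g A = f a u" if "u \<in> U" for u
  proof -
    have u: "u \<in> V'" "a \<in> V'" "u \<noteq> a" using that aU unfolding V'_def by auto
    have "f a u \<le> m' a u" using f(1)[of a u] f(1)[of u a] u by linarith
    then show ?thesis
      using sum_distribute[OF fA, of "\<lambda>w. m w u" "f a u"] m_nonneg f(1)[of a u] u by (auto simp: m'_def)
  qed
  then obtain g where g: "\<And>u w. u \<in> U \<Longrightarrow> 0 \<le> g u w \<and> g u w \<le> m w u" "\<And>u. u \<in> U \<Longrightarrow> sum (g u) A = f a u"
    by metis
  have g': "(\<Sum>w\<in>A. m w u - g u w) = f u a" if "u \<in> U" for u
  proof -
    have u: "u \<in> V'" "a \<in> V'" "u \<noteq> a" using that aU unfolding V'_def by auto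
    have "f a u + f u a = (\<Sum>w\<in>A. m w u)" using f(1)[of a u] u by (auto simp: m'_def)
    then show ?thesis using g(2)[OF that] by (simp add: sum_subtractf)
  qed
  define p2 where "p2 w = p w + (\<Sum>u\<in>U. g u w)" for w
  define q2 where "q2 w = q w + (\<Sum>u\<in>U. m w u - g u w)" for w
  have pq2: "p2 w + q2 w = p w + q w + (\<Sum>u\<in>U. m w u)" for w
    unfolding p2_def q2_def by (simp add: sum_subtractf)
  have dd2: "cut_degree m p2 q2 A B = cut_degree m p q V B" if "B \<subseteq> A" for B
  proof -
    have "sum p2 B + sum q2 B = (\<Sum>w\<in>B. p w + q w + (\<Sum>u\<in>U. m w u))"
      using pq2 by (simp add: sum.distrib[symmetric])
    also have "\<dots> = sum p B + sum q B + (\<Sum>w\<in>B. \<Sum>u\<in>U. m w u)" by (simp add: sum.distrib)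
    finally have 1: "sum p2 B + sum q2 B = \<dots>" .
    have "(\<Sum>u\<in>V - B. m w u) = (\<Sum>u\<in>A - B. m w u) + (\<Sum>u\<in>U. m w u)" for w
    proof -
      have "V - B = (A - B) \<union> U" using that UA by auto
      then show ?thesis using sum.union_disjoint[of "A - B" U "m w"] fA fU UA by auto
    qed
    then show ?thesis unfolding cut_degree_def using 1 by (simp add: sum.distrib)
  qed
  have neta: "(\<Sum>u\<in>V'. f a u - f u a) = (\<Sum>w\<in>A. (p2 w - q2 w) - (p w - q w))"
  proof -
    have "(\<Sum>u\<in>V'. f a u - f u a) = (\<Sum>u\<in>U. f a u - f u a)" unfolding V'_def using fU aU by simp
    also have "\<dots> = (\<Sum>u\<in>U. (\<Sum>w\<in>A. g u w - (m w u - g u w)))"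
    proof (rule sum.cong[OF refl])
      fix u assume u: "u \<in> U"
      show "f a u - f u a = (\<Sum>w\<in>A. g u w - (m w u - g u w))"
        unfolding sum_subtractf[of "g u"] using g(2)[OF u] g'[OF u] by simp
    qed
    also have "\<dots> = (\<Sum>w\<in>A. \<Sum>u\<in>U. g u w - (m w u - g u w))" by (rule sum.swap)
    also have "\<dots> = (\<Sum>w\<in>A. (p2 w - q2 w) - (p w - q w))"
      unfolding p2_def q2_def by (intro sum.cong) (auto simp: sum_subtractf sum_distrib_left)
    finally show ?thesis .
  qed
  have S2: "orientation_state k A m b (\<lambda>w. if w \<in> A then p2 w else 0) (\<lambda>w. if w \<in> A then q2 w else 0) (X \<inter> A)"
  proof
    show "2 \<le> k" by (rule k2)
    show "finite A" by (rule fA)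
    show "0 \<le> m u v" for u v by (rule m_nonneg)
    show "m u v = m v u" for u v by (rule m_sym)
    show "m v v = 0" for v by (rule m_diag)
    show "0 \<le> (if v \<in> A then p2 v else 0)" for v
      unfolding p2_def using p_nonneg g(1) by (auto intro!: add_nonneg_nonneg sum_nonneg)
    show "0 \<le> (if v \<in> A then q2 v else 0)" for v
      unfolding q2_def using q_nonneg g(1) by (auto intro!: add_nonneg_nonneg sum_nonneg)
    have "2 * k dvd (\<Sum>w\<in>A. (p2 w - q2 w) - (p w - q w)) + sum p A - sum q A - sum b A"
      using f(2)[of a] unfolding neta by (simp add: V'_def ct_def)
    then have "2 * k dvd - (\<Sum>v\<in>A. b v - p2 v + q2 v)"
      by (simp add: sum.distrib sum_subtractf algebra_simps)
    then have "2 * k dvd (\<Sum>v\<in>A. b v - p2 v + q2 v)" by (simp only: dvd_minus_iff)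
    then show "2 * k dvd (\<Sum>v\<in>A. b v - (if v \<in> A then p2 v else 0) + (if v \<in> A then q2 v else 0))"
      by simp
    \<comment> \<open>Now all edges leaving \<open>A\<close> are pre-oriented, so the bound on their
      number is exactly the tightness of \<open>A\<close>.\<close>
    have "cut_degree m p2 q2 A A = sum p2 A + sum q2 A" unfolding cut_degree_def by simp
    then show "(\<Sum>v\<in>A. if v \<in> A then p2 v else 0) + (\<Sum>v\<in>A. if v \<in> A then q2 v else 0) \<le> 2 * k - 2 + circ_norm k (sum b A)"
      using A(4) dd2[of A] by simp
    show "even (b v - (if v \<in> A then p2 v else 0) + (if v \<in> A then q2 v else 0) + (\<Sum>u\<in>A. m v u))" if "v \<in> A" for v
    proof -
      have "(\<Sum>u\<in>V. m v u) = (\<Sum>u\<in>U. m v u) + (\<Sum>u\<in>A. m v u)"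
        unfolding UA(2) using fU fA UA(1) by (intro sum.union_disjoint) auto
      moreover have "even (b v - p v + q v + (\<Sum>u\<in>V. m v u))" using parity that A by blast
      ultimately have "even (b v - p v + q v + ((\<Sum>u\<in>U. m v u) + (\<Sum>u\<in>A. m v u)))" by simp
      then have "even (b v - p v + q v + ((\<Sum>u\<in>U. m v u) + (\<Sum>u\<in>A. m v u)) + 2 * (q2 v - q v - (\<Sum>u\<in>U. m v u)))"
        by (rule dvd_add) simp
      also have "b v - p v + q v + ((\<Sum>u\<in>U. m v u) + (\<Sum>u\<in>A. m v u)) + 2 * (q2 v - q v - (\<Sum>u\<in>U. m v u))
          = b v - p2 v + q2 v + (\<Sum>u\<in>A. m v u)"
        using pq2[of v] by (simp add: algebra_simps)
      finally show ?thesis using that by simp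
    qed
    show "X \<inter> A = {} \<or> (\<exists>v\<in>A. X \<inter> A = {v} \<and> 2 * k dvd b v)" using exempt by auto
    fix B assume B: "B \<subseteq> A" "B \<noteq> {}" "B \<noteq> A" "B \<noteq> X \<inter> A"
    have "cut_degree m (\<lambda>w. if w \<in> A then p2 w else 0) (\<lambda>w. if w \<in> A then q2 w else 0) A B = cut_degree m p2 q2 A B"
      unfolding cut_degree_def using B(1) by (intro arg_cong2[where f = "(+)"] sum.cong) auto
    moreover have "B \<noteq> X" using B exempt by auto
    ultimately show "2 * k - 2 + circ_norm k (sum b B) \<le>
      cut_degree m (\<lambda>w. if w \<in> A then p2 w else 0) (\<lambda>w. if w \<in> A then q2 w else 0) A B"
      using cuts[of B] B A dd2[of B] by auto
  qed
  have "card A < card V" using A fin by (metis psubsetI psubset_card_mono)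
  then have "mod_orientable k A m b (\<lambda>w. if w \<in> A then p2 w else 0) (\<lambda>w. if w \<in> A then q2 w else 0)"
    using IH[OF S2] by (simp add: state_size_def)
  then obtain h where h: "\<And>u v. u \<in> A \<Longrightarrow> v \<in> A \<Longrightarrow> 0 \<le> h u v \<and> h u v + h v u = m u v"
    and h': "\<And>v. v \<in> A \<Longrightarrow> 2 * k dvd (\<Sum>u\<in>A. h v u - h u v) + (if v \<in> A then p2 v else 0)
      - (if v \<in> A then q2 v else 0) - b v"
    unfolding mod_orientable_def by blast
  define F where "F u v = (if u \<in> A then (if v \<in> A then h u v else g v u)
    else if v \<in> A then m v u - g u v else f u v)" for u v
  have "0 \<le> F u v \<and> F u v + F v u = m u v" if "u \<in> V" "v \<in> V" for u v
  proof -
    have "u \<in> A \<or> u \<in> U" "v \<in> A \<or> v \<in> U" using that UA by auto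
    moreover have "u \<in> U \<Longrightarrow> v \<in> U \<Longrightarrow> m' u v = m u v" using aU by (auto simp: m'_def)
    ultimately show ?thesis
      using h[of u v] g(1)[of v u] g(1)[of u v] f(1)[of u v] m_sym[of u v] UA(1)
      unfolding F_def V'_def by auto
  qed
  moreover have "2 * k dvd (\<Sum>u\<in>V. F v u - F u v) + p v - q v - b v" if "v \<in> V" for v
  proof -
    have split: "(\<Sum>u\<in>V. F v u - F u v) = (\<Sum>u\<in>U. F v u - F u v) + (\<Sum>u\<in>A. F v u - F u v)"
      unfolding UA(2) using fU fA UA(1) by (intro sum.union_disjoint) auto
    show ?thesis
    proof (cases "v \<in> A")
      case True
      have "(\<Sum>u\<in>U. F v u - F u v) = (\<Sum>u\<in>U. g u v - (m v u - g u v))"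
        using True UA(1) by (intro sum.cong) (auto simp: F_def)
      also have "\<dots> = (p2 v - q2 v) - (p v - q v)"
        unfolding p2_def q2_def by (simp add: sum_subtractf sum_distrib_left)
      finally have E: "(\<Sum>u\<in>V. F v u - F u v) + p v - q v - b v = (\<Sum>u\<in>A. h v u - h u v) + p2 v - q2 v - b v"
        unfolding split using True by (simp add: F_def)
      have "2 * k dvd (\<Sum>u\<in>A. h v u - h u v) + p2 v - q2 v - b v" using h'[OF True] True by simp
      then show ?thesis unfolding E .
    next
      case False
      then have v: "v \<in> U" using that UA by auto
      have va: "v \<noteq> a" using v aU by auto
      have "(\<Sum>u\<in>U. F v u - F u v) = (\<Sum>u\<in>U. f v u - f u v)"
        using False UA(1) by (intro sum.cong) (auto simp: F_def)
      moreover have "(\<Sum>u\<in>A. F v u - F u v) = (\<Sum>u\<in>A. (m u v - g v u) - g v u)"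
        using False by (intro sum.cong) (auto simp: F_def)
      moreover have "\<dots> = f v a - f a v"
        by (simp only: sum_subtractf[of "\<lambda>u. m u v - g v u" "g v" A] g'[OF v] g(2)[OF v])
      moreover have "(\<Sum>u\<in>V'. f v u - f u v) = (f v a - f a v) + (\<Sum>u\<in>U. f v u - f u v)"
        unfolding V'_def using fU aU by simp
      ultimately have E: "(\<Sum>u\<in>V. F v u - F u v) = (\<Sum>u\<in>V'. f v u - f u v)"
        unfolding split by linarith
      have "v \<in> V'" using v unfolding V'_def by simp
      then show ?thesis using f(2)[of v] va unfolding E by (simp add: ct_def)
    qed
  qed
  ultimately show ?thesis unfolding mod_orientable_def by blast
qed

end

section \<open>Multiplicities under adding and deleting edges\<close>

definition arc :: "'v \<Rightarrow> 'v \<Rightarrow> 'v \<Rightarrow> 'v \<Rightarrow> int" where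
  "arc x y u v = of_bool (u = x \<and> v = y)"

text \<open>Both ordered pairs change, which keeps multiplicities symmetric; a negative
  \<open>c\<close> deletes parallel edges.\<close>

definition add_edges :: "int \<Rightarrow> 'v \<Rightarrow> 'v \<Rightarrow> ('v \<Rightarrow> 'v \<Rightarrow> int) \<Rightarrow> 'v \<Rightarrow> 'v \<Rightarrow> int" where
  "add_edges c x y m u v = m u v + c * (arc x y u v + arc y x u v)"

lemma arc_swap: "arc y x u v = arc x y v u"
  unfolding arc_def by (simp add: conj_commute)

lemma arc_nonneg: "0 \<le> arc x y u v"
  unfolding arc_def by simp

lemma sum_of_bool_point:
  assumes "finite A" shows "(\<Sum>u\<in>A. of_bool (u = x)) = (of_bool (x \<in> A) :: int)"
  using assms by (simp add: of_bool_def sum.delta')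

lemma sum_arc_row: "finite B \<Longrightarrow> (\<Sum>v\<in>B. arc x y u v) = of_bool (u = x \<and> y \<in> B)"
  unfolding arc_def of_bool_conj by (simp add: sum_distrib_left[symmetric] sum_of_bool_point)

lemma sum_arc_col: "finite B \<Longrightarrow> (\<Sum>u\<in>B. arc x y u v) = of_bool (v = y \<and> x \<in> B)"
  unfolding arc_def of_bool_conj by (simp add: sum_distrib_right[symmetric] sum_of_bool_point)

lemma sum_arc: "finite A \<Longrightarrow> finite B \<Longrightarrow> (\<Sum>u\<in>A. \<Sum>v\<in>B. arc x y u v) = of_bool (x \<in> A \<and> y \<in> B)"
  by (simp add: sum_arc_row of_bool_conj sum_distrib_right[symmetric] sum_of_bool_point)

lemma sum_add_edges_row:
  "finite B \<Longrightarrow> (\<Sum>v\<in>B. add_edges c x y m u v) = (\<Sum>v\<in>B. m u v) + c * (of_bool (u = x \<and> y \<in> B) + of_bool (u = y \<and> x \<in> B))"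
  unfolding add_edges_def by (simp add: sum.distrib sum_distrib_left[symmetric] sum_arc_row)

lemma sum_add_edges:
  "finite A \<Longrightarrow> finite B \<Longrightarrow> (\<Sum>u\<in>A. \<Sum>v\<in>B. add_edges c x y m u v) =
    (\<Sum>u\<in>A. \<Sum>v\<in>B. m u v) + c * (of_bool (x \<in> A \<and> y \<in> B) + of_bool (y \<in> A \<and> x \<in> B))"
  unfolding add_edges_def by (simp add: sum.distrib sum_distrib_left[symmetric] sum_arc)

lemma cut_degree_add_edges:
  assumes "finite V" "A \<subseteq> V" "x \<in> V" "y \<in> V"
  shows "cut_degree (add_edges c x y m) p q V A = cut_degree m p q V A
    + c * (of_bool (x \<in> A \<and> y \<notin> A) + of_bool (y \<in> A \<and> x \<notin> A))"
  using assms finite_subset[OF assms(2,1)] unfolding cut_degree_def by (simp add: sum_add_edges)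

section \<open>Deleting an edge, lifting a pair of edges, removing a vertex\<close>

context induction_state
begin

text \<open>One copy of the edge is directed from \<open>x\<close> to \<open>y\<close> and removed,
  so the net demand within \<open>V\<close> falls by one at \<open>x\<close> and rises by one at
  \<open>y\<close>. Whether demands or pre-oriented edges absorb this is left open, since the
  applications differ in it. A set separating \<open>x\<close> from \<open>y\<close> loses an edge,
  hence the extra term in the cut condition.\<close>

lemma delete_edge:
  assumes xy: "x \<in> V" "y \<in> V" "x \<noteq> y" "1 \<le> m x y"
    and pq: "\<And>v. 0 \<le> p' v" "\<And>v. 0 \<le> q' v"
    and rel: "\<And>v. b' v - p' v + q' v = b v - p v + q v - of_bool (v = x) + of_bool (v = y)"
    and tok: "sum p' V + sum q' V \<le> 2 * k - 2 + circ_norm k (sum b' V)"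
    and ex: "X' = {} \<or> (\<exists>v\<in>V. X' = {v} \<and> 2 * k dvd b' v)"
    and ct: "\<And>A. A \<subseteq> V \<Longrightarrow> A \<noteq> {} \<Longrightarrow> A \<noteq> V \<Longrightarrow> A \<noteq> X' \<Longrightarrow>
      2 * k - 2 + circ_norm k (sum b' A) + (of_bool (x \<in> A \<and> y \<notin> A) + of_bool (y \<in> A \<and> x \<notin> A)) \<le> cut_degree m p' q' V A"
  shows "mod_orientable k V m b p q"
proof -
  let ?m = "add_edges (-1) x y m"
  have nn: "0 \<le> ?m u v" for u v
    using m_nonneg[of u v] xy m_sym[of x y] unfolding add_edges_def arc_def by auto
  have S: "orientation_state k V ?m b' p' q' X'"
  proof
    show "2 \<le> k" "finite V" by (rule k2 fin)+
    show "0 \<le> ?m u v" for u v by (rule nn)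
    show "?m u v = ?m v u" for u v unfolding add_edges_def arc_def using m_sym[of u v] by (simp add: add.commute conj_commute)
    show "?m v v = 0" for v unfolding add_edges_def arc_def using xy(3) m_diag by auto
    show "0 \<le> p' v" "0 \<le> q' v" for v by (rule pq)+
    show "2 * k dvd (\<Sum>v\<in>V. b' v - p' v + q' v)"
    proof -
      have "(\<Sum>v\<in>V. b' v - p' v + q' v) = (\<Sum>v\<in>V. b v - p v + q v)"
        unfolding rel using xy fin by (simp add: sum.distrib sum_subtractf sum_of_bool_point)
      then show ?thesis using balance by simp
    qed
    show "even (b' v - p' v + q' v + (\<Sum>u\<in>V. ?m v u))" if "v \<in> V" for v
    proof -
      have "(\<Sum>u\<in>V. ?m v u) = (\<Sum>u\<in>V. m v u) - of_bool (v = x) - of_bool (v = y)"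
        using xy by (simp add: sum_add_edges_row[OF fin])
      then have "b' v - p' v + q' v + (\<Sum>u\<in>V. ?m v u)
          = b v - p v + q v + (\<Sum>u\<in>V. m v u) - 2 * of_bool (v = x)"
        using rel[of v] by linarith
      then show ?thesis using parity[OF that] by simp
    qed
    show "sum p' V + sum q' V \<le> 2 * k - 2 + circ_norm k (sum b' V)" by (rule tok)
    show "X' = {} \<or> (\<exists>v\<in>V. X' = {v} \<and> 2 * k dvd b' v)" by (rule ex)
    show "2 * k - 2 + circ_norm k (sum b' A) \<le> cut_degree ?m p' q' V A"
      if "A \<subseteq> V" "A \<noteq> {}" "A \<noteq> V" "A \<noteq> X'" for A
      using ct[OF that] xy unfolding cut_degree_add_edges[OF fin that(1) xy(1,2)] by simp
  qed
  have "0 \<le> (\<Sum>u\<in>V. \<Sum>v\<in>V. ?m u v)" using nn by (intro sum_nonneg)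
  moreover have "(\<Sum>u\<in>V. \<Sum>v\<in>V. ?m u v) = (\<Sum>u\<in>V. \<Sum>v\<in>V. m u v) - 2"
    using xy by (simp add: sum_add_edges[OF fin fin])
  ultimately have "(state_size V ?m p' q', state_size V m p q) \<in> smaller"
    unfolding state_size_def by (simp add: nat_less_iff)
  from IH[OF S this] obtain f where f: "\<And>u v. u \<in> V \<Longrightarrow> v \<in> V \<Longrightarrow> 0 \<le> f u v \<and> f u v + f v u = ?m u v"
    "\<And>v. v \<in> V \<Longrightarrow> 2 * k dvd (\<Sum>u\<in>V. f v u - f u v) + p' v - q' v - b' v"
    unfolding mod_orientable_def by blast
  have "2 * k dvd (\<Sum>u\<in>V. (f v u + arc x y v u) - (f u v + arc x y u v)) + p v - q v - b v" if "v \<in> V" for v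
  proof -
    have "(\<Sum>u\<in>V. (f v u + arc x y v u) - (f u v + arc x y u v))
        = (\<Sum>u\<in>V. f v u - f u v) + of_bool (v = x) - of_bool (v = y)"
      using fin xy by (simp add: sum.distrib sum_subtractf sum_arc_row sum_arc_col)
    then have "(\<Sum>u\<in>V. (f v u + arc x y v u) - (f u v + arc x y u v)) + p v - q v - b v
      = (\<Sum>u\<in>V. f v u - f u v) + p' v - q' v - b' v" using rel[of v] by linarith
    then show ?thesis using f(2)[OF that] by simp
  qed
  moreover have "0 \<le> f u v + arc x y u v \<and> (f u v + arc x y u v) + (f v u + arc x y v u) = m u v"
    if "u \<in> V" "v \<in> V" for u v
    using f(1)[OF that] arc_swap[of y x u v] by (simp add: add_edges_def arc_nonneg)
  ultimately show ?thesis unfolding mod_orientable_def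
    by (intro exI[of _ "\<lambda>u v. f u v + arc x y u v"]) auto
qed

text \<open>The edges \<open>vx\<close> and \<open>vy\<close> are replaced by \<open>xy\<close>. A
  cut loses two edges only if it separates \<open>v\<close> from both \<open>x\<close> and
  \<open>y\<close>; sets with at least two vertices afford this by their slack, a single vertex
  other than \<open>v\<close> cannot contain both, and \<open>{v}\<close> becomes exempt.\<close>

lemma lift_edges:
  assumes vxy: "v \<in> V" "x \<in> V" "y \<in> V" "v \<noteq> x" "v \<noteq> y" "x \<noteq> y" "1 \<le> m v x" "1 \<le> m v y"
    and zero: "2 * k dvd b v"
    and slack: "\<And>A. A \<subseteq> V \<Longrightarrow> 2 \<le> card A \<Longrightarrow> A \<noteq> V \<Longrightarrow> 2 * k + circ_norm k (sum b A) \<le> cut_degree m p q V A"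
    and sing: "\<And>u. u \<in> V \<Longrightarrow> u \<noteq> v \<Longrightarrow> {u} \<noteq> V \<Longrightarrow> 2 * k - 2 + circ_norm k (b u) \<le> cut_degree m p q V {u}"
  shows "mod_orientable k V m b p q"
proof -
  let ?m1 = "add_edges (-1) v y m"
  let ?m2 = "add_edges (-1) v x ?m1"
  let ?m = "add_edges 1 x y ?m2"
  have nn: "0 \<le> ?m u w" for u w
    using m_nonneg[of u w] vxy m_sym[of v x] m_sym[of v y] unfolding add_edges_def arc_def by auto
  have S: "orientation_state k V ?m b p q {v}"
  proof
    show "2 \<le> k" "finite V" by (rule k2 fin)+
    show "0 \<le> ?m u v" for u v by (rule nn)
    show "?m u v = ?m v u" for u v unfolding add_edges_def arc_def using m_sym[of u v] by (simp add: add.commute conj_commute)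
    show "?m w w = 0" for w unfolding add_edges_def arc_def using vxy(4-6) m_diag by auto
    show "0 \<le> p v" "0 \<le> q v" for v by (rule p_nonneg q_nonneg)+
    show "2 * k dvd (\<Sum>v\<in>V. b v - p v + q v)" by (rule balance)
    show "even (b w - p w + q w + (\<Sum>u\<in>V. ?m w u))" if "w \<in> V" for w
    proof -
      have "(\<Sum>u\<in>V. ?m w u) = (\<Sum>u\<in>V. m w u) - 2 * of_bool (w = v)"
        using vxy by (simp add: sum_add_edges_row[OF fin])
      then have "b w - p w + q w + (\<Sum>u\<in>V. ?m w u)
          = b w - p w + q w + (\<Sum>u\<in>V. m w u) - 2 * of_bool (w = v)" by linarith
      then show ?thesis using parity[OF that] by simp
    qed
    show "sum p V + sum q V \<le> 2 * k - 2 + circ_norm k (sum b V)" by (rule tokens)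
    show "{v} = {} \<or> (\<exists>u\<in>V. {v} = {u} \<and> 2 * k dvd b u)" using zero vxy by auto
    fix A assume A: "A \<subseteq> V" "A \<noteq> {}" "A \<noteq> V" "A \<noteq> {v}"
    have e: "cut_degree ?m p q V A = cut_degree m p q V A
      - (of_bool (v \<in> A \<and> y \<notin> A) + of_bool (y \<in> A \<and> v \<notin> A))
      - (of_bool (v \<in> A \<and> x \<notin> A) + of_bool (x \<in> A \<and> v \<notin> A))
      + (of_bool (x \<in> A \<and> y \<notin> A) + of_bool (y \<in> A \<and> x \<notin> A))"
      using vxy A(1) fin by (simp add: cut_degree_add_edges)
    show "2 * k - 2 + circ_norm k (sum b A) \<le> cut_degree ?m p q V A"
    proof (cases "2 \<le> card A")
      case True
      then show ?thesis using slack[OF A(1) True A(3)] unfolding e by auto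
    next
      case False
      moreover have "card A \<noteq> 0" using A finite_sub by auto
      ultimately have "card A = 1" by linarith
      then obtain u where u: "A = {u}" by (metis card_1_singletonE)
      then show ?thesis using sing[of u] A vxy unfolding e by auto
    qed
  qed
  have "0 \<le> (\<Sum>u\<in>V. \<Sum>v\<in>V. ?m u v)" using nn by (intro sum_nonneg)
  moreover have "(\<Sum>u\<in>V. \<Sum>v\<in>V. ?m u v) = (\<Sum>u\<in>V. \<Sum>v\<in>V. m u v) - 2"
    using vxy by (simp add: sum_add_edges[OF fin fin])
  ultimately have "(state_size V ?m p q, state_size V m p q) \<in> smaller"
    unfolding state_size_def by (simp add: nat_less_iff)
  from IH[OF S this] obtain f where f: "\<And>u v. u \<in> V \<Longrightarrow> v \<in> V \<Longrightarrow> 0 \<le> f u v \<and> f u v + f v u = ?m u v"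
    "\<And>v. v \<in> V \<Longrightarrow> 2 * k dvd (\<Sum>u\<in>V. f v u - f u v) + p v - q v - b v"
    unfolding mod_orientable_def by blast
  \<comment> \<open>One arc from \<open>s\<close> to \<open>t\<close> is rerouted through
    \<open>v\<close>, which preserves all net out-degrees. The new edge may have been directed
    either way, so \<open>s\<close> and \<open>t\<close> are kept general.\<close>
  have key: ?thesis
    if st: "s \<in> V" "t \<in> V" "v \<noteq> s" "v \<noteq> t" "s \<noteq> t" "1 \<le> f s t"
      and fm: "\<And>u w. u \<in> V \<Longrightarrow> w \<in> V \<Longrightarrow> f u w + f w u = add_edges 1 s t (add_edges (-1) v s (add_edges (-1) v t m)) u w" for s t
  proof -
    define F where "F u w = f u w - arc s t u w + arc s v u w + arc v t u w" for u w
    have "2 * k dvd (\<Sum>u\<in>V. F w u - F u w) + p w - q w - b w" if "w \<in> V" for w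
    proof -
      have "(\<Sum>u\<in>V. F w u - F u w) = (\<Sum>u\<in>V. f w u - f u w)"
        unfolding F_def using fin st vxy(1)
        by (simp add: sum.distrib sum_subtractf sum_arc_row sum_arc_col)
      then show ?thesis using f(2)[OF that] by simp
    qed
    moreover have "0 \<le> F u w" if "u \<in> V" "w \<in> V" for u w
      using f(1)[OF that] st unfolding F_def arc_def by auto
    moreover have "F u w + F w u = m u w" if "u \<in> V" "w \<in> V" for u w
      using fm[OF that] arc_swap[of t s u w] arc_swap[of v s u w] arc_swap[of t v u w]
      by (simp add: F_def add_edges_def)
    ultimately show ?thesis unfolding mod_orientable_def by blast
  qed
  have swap: "add_edges 1 y x (add_edges (-1) v y (add_edges (-1) v x m)) u w = ?m u w" for u w
    unfolding add_edges_def by (simp add: algebra_simps)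
  have "?m x y = m x y + 1" using vxy unfolding add_edges_def arc_def by auto
  then have "1 \<le> f x y \<or> 1 \<le> f y x" using f(1)[of x y] m_nonneg[of x y] vxy by linarith
  then show ?thesis
  proof
    assume 1: "1 \<le> f x y"
    show ?thesis
    proof (rule key[OF vxy(2,3,4,5,6) 1])
      fix u w assume "u \<in> V" "w \<in> V"
      then show "f u w + f w u = ?m u w" using f(1) by blast
    qed
  next
    assume 1: "1 \<le> f y x"
    show ?thesis
    proof (rule key[OF vxy(3,2,5,4) vxy(6)[symmetric] 1])
      fix u w assume "u \<in> V" "w \<in> V"
      then show "f u w + f w u = add_edges 1 y x (add_edges (-1) v y (add_edges (-1) v x m)) u w"
        unfolding swap using f(1) by blast
    qed
  qed
qed

text \<open>Parity at \<open>v\<close> makes the multiplicity towards \<open>x\<close> even, so half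
  of these edges can go each way and \<open>v\<close> is balanced. A cut of the remaining graph
  equals the cut of \<open>V\<close> that keeps \<open>v\<close> on the side of
  \<open>x\<close>.\<close>

lemma remove_vertex:
  assumes vx: "v \<in> V" "x \<in> V" "v \<noteq> x" and nbr: "\<And>u. u \<in> V \<Longrightarrow> u \<noteq> x \<Longrightarrow> m v u = 0"
    and zero: "2 * k dvd b v" "p v = 0" "q v = 0" and X: "X = {} \<or> X = {v}"
  shows "mod_orientable k V m b p q"
proof -
  define U where "U = V - {v}"
  have fU: "finite U" and V: "V = insert v U" and vU: "v \<notin> U" and xU: "x \<in> U"
    using fin vx unfolding U_def by auto
  have nbrU: "m v u = (if u = x then m v x else 0)" if "u \<in> U" for u using nbr[of u] that V by auto
  have row: "(\<Sum>u\<in>B. m v u) = (if x \<in> B then m v x else 0)" if "B \<subseteq> U" for B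
  proof -
    have "(\<Sum>u\<in>B. m v u) = (\<Sum>u\<in>B. if x = u then m v x else 0)"
      using nbrU that by (intro sum.cong) auto
    then show ?thesis using finite_subset[OF that fU] by (simp add: sum.delta)
  qed
  have ev: "even (m v x)"
  proof -
    have "even (b v)" using zero(1) by (metis dvd_mult_left)
    moreover have "(\<Sum>u\<in>V. m v u) = m v x" unfolding V using fU vU row[of U] xU m_diag by simp
    ultimately show ?thesis using parity[OF vx(1)] zero by simp
  qed
  have S: "orientation_state k U m b p q {}"
  proof
    show "2 \<le> k" "finite U" by (rule k2 fU)+
    show "0 \<le> m u v" "m u v = m v u" "m v v = 0" for u v by (rule m_nonneg m_sym m_diag)+
    show "0 \<le> p v" "0 \<le> q v" for v by (rule p_nonneg q_nonneg)+
    have "2 * k dvd (b v - p v + q v) + (\<Sum>v\<in>U. b v - p v + q v)"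
      using balance unfolding V using fU vU by simp
    then show "2 * k dvd (\<Sum>v\<in>U. b v - p v + q v)"
      using zero by (simp add: dvd_add_right_iff)
    show "even (b w - p w + q w + (\<Sum>u\<in>U. m w u))" if "w \<in> U" for w
    proof -
      have "(\<Sum>u\<in>V. m w u) = m v w + (\<Sum>u\<in>U. m w u)" unfolding V using fU vU m_sym[of v w] by simp
      moreover have "even (m v w)" using nbrU[OF that] ev by auto
      ultimately show ?thesis using parity[of w] that V by auto
    qed
    have "sum b V = b v + sum b U" unfolding V using fU vU by simp
    then have "circ_norm k (sum b U) = circ_norm k (sum b V)" using zero by (intro circ_norm_cong) simp
    then show "sum p U + sum q U \<le> 2 * k - 2 + circ_norm k (sum b U)"
      using tokens unfolding V using fU vU zero by simp
    show "{} = {} \<or> (\<exists>v\<in>U. {} = {v} \<and> 2 * k dvd b v)" by simp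
    fix A assume A: "A \<subseteq> U" "A \<noteq> {}" "A \<noteq> U" "A \<noteq> {}"
    have fA: "finite A" and vA: "v \<notin> A" using A fU vU finite_subset by auto
    show "2 * k - 2 + circ_norm k (sum b A) \<le> cut_degree m p q U A"
    proof (cases "x \<in> A")
      case True
      let ?A = "insert v A"
      have "V - ?A = U - A" using V vU by auto
      then have "(\<Sum>u\<in>?A. \<Sum>w\<in>V - ?A. m u w) = (\<Sum>u\<in>A. \<Sum>w\<in>U - A. m u w)"
        using fA vA row[of "U - A"] True by simp
      then have "cut_degree m p q V ?A = cut_degree m p q U A" unfolding cut_degree_def using fA vA zero by simp
      moreover have "circ_norm k (sum b ?A) = circ_norm k (sum b A)" using fA vA zero by (intro circ_norm_cong) simp
      moreover have "?A \<noteq> X" using X True vx by auto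
      moreover have "?A \<noteq> V" unfolding V using A(3) vA vU by (metis Diff_insert_absorb)
      moreover have "?A \<subseteq> V" unfolding V using A(1) by auto
      ultimately show ?thesis using cuts[of ?A] by simp
    next
      case False
      have "(\<Sum>w\<in>V - A. m u w) = (\<Sum>w\<in>U - A. m u w)" if "u \<in> A" for u
      proof -
        have "V - A = insert v (U - A)" using V vA by auto
        moreover have "u \<in> U" "u \<noteq> x" using that A(1) False by auto
        then have "m u v = 0" using nbrU[of u] m_sym[of u v] by simp
        ultimately show ?thesis using fU vU by simp
      qed
      then have "cut_degree m p q V A = cut_degree m p q U A" unfolding cut_degree_def by simp
      moreover have "A \<subseteq> V" "A \<noteq> V" "A \<noteq> X" using A(1,2) V X vA by auto
      ultimately show ?thesis using cuts[of A] A(2) by simp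
    qed
  qed
  have "(state_size U m p q, state_size V m p q) \<in> smaller" unfolding state_size_def V using fU vU by simp
  from IH[OF S this] obtain f where f: "\<And>u v. u \<in> U \<Longrightarrow> v \<in> U \<Longrightarrow> 0 \<le> f u v \<and> f u v + f v u = m u v"
    "\<And>v. v \<in> U \<Longrightarrow> 2 * k dvd (\<Sum>u\<in>U. f v u - f u v) + p v - q v - b v"
    unfolding mod_orientable_def by blast
  define F where "F u w = (if u = v \<or> w = v then m u w div 2 else f u w)" for u w
  have "0 \<le> F u w \<and> F u w + F w u = m u w" if "u \<in> V" "w \<in> V" for u w
  proof (cases "u = v \<or> w = v")
    case True
    have E: "even (m v z)" if "z \<in> V" for z using nbr[OF that] ev by (cases "z = x") auto
    have s: "m w u = m u w" by (rule m_sym)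
    have "even (m u w)"
    proof (cases "u = v")
      case False
      then have "w = v" using True by simp
      then show ?thesis using E[of u] that s by simp
    qed (use E[of w] that in simp)
    then show ?thesis using True m_nonneg[of u w] s unfolding F_def by auto
  next
    case False
    then show ?thesis using f(1)[of u w] that V unfolding F_def by auto
  qed
  moreover have "2 * k dvd (\<Sum>u\<in>V. F w u - F u w) + p w - q w - b w" if "w \<in> V" for w
  proof (cases "w = v")
    case True
    have "F w u - F u w = 0" for u using True m_sym[of w u] by (simp only: F_def) simp
    then have "(\<Sum>u\<in>V. F w u - F u w) = 0" by simp
    then show ?thesis using True zero by simp
  next
    case False
    have "F w v - F v w = 0" using m_sym[of v w] by (simp only: F_def) simp
    moreover have "(\<Sum>u\<in>U. F w u - F u w) = (\<Sum>u\<in>U. f w u - f u w)"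
      using False vU by (intro sum.cong) (auto simp: F_def)
    ultimately show ?thesis using f(2)[of w] that False V fU vU by simp
  qed
  ultimately show ?thesis unfolding mod_orientable_def by blast
qed

text \<open>In a counterexample no such set is tight, by contraction, and parity excludes the value
  one above the minimum.\<close>

lemma slack:
  assumes "\<not> mod_orientable k V m b p q" and A: "A \<subseteq> V" "A \<noteq> V" "2 \<le> card A"
  shows "2 * k + circ_norm k (sum b A) \<le> cut_degree m p q V A"
proof -
  have "2 * k - 2 + circ_norm k (sum b A) < cut_degree m p q V A" using contract[OF A] assms(1) by linarith
  moreover have "even (cut_degree m p q V A - sum b A)" using cut_degree_parity A by blast
  then have "even (cut_degree m p q V A - circ_norm k (sum b A))" using circ_norm_even[OF k0] by simp
  then have "cut_degree m p q V A \<noteq> 2 * k - 1 + circ_norm k (sum b A)" by auto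
  ultimately show ?thesis by linarith
qed

lemma card_ge_2:
  assumes "A \<subseteq> V" "x \<in> A" "A \<noteq> {x}" shows "2 \<le> card A"
proof -
  have "finite A" using assms finite_sub by blast
  then have "card A \<noteq> 0" "card A \<noteq> 1" using assms by (auto simp: card_1_singleton_iff)
  then show ?thesis by linarith
qed

lemma sum_scaled_of_bool: "A \<subseteq> V \<Longrightarrow> (\<Sum>u\<in>A. c * of_bool (u = x)) = c * (of_bool (x \<in> A) :: int)"
  using finite_sub sum_of_bool_point[of A x] by (simp add: sum_distrib_left[symmetric])

section \<open>Excluding zero demands, demands of opposite sign and demands of one sign\<close>

text \<open>
  A vertex with zero demand is exempted and dissolved by lifting pairs of edges at it, where one
  edge of a pair may be pre-oriented.
\<close>

lemma zero_vertex:
  assumes v: "v \<in> V" "2 * k dvd b v" "X = {} \<or> X = {v}" "2 \<le> card V"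
  shows "mod_orientable k V m b p q"
proof (rule ccontr)
  assume ns: "\<not> mod_orientable k V m b p q"
  have sing: "2 * k - 2 + circ_norm k (b u) \<le> cut_degree m p q V {u}" if "u \<in> V" "u \<noteq> v" "{u} \<noteq> V" for u
    using cuts[of "{u}"] that v by auto
  have ct: "2 * k - 2 + circ_norm k (sum b A) \<le> cut_degree m p q V A" if "A \<subseteq> V" "A \<noteq> {}" "A \<noteq> V" "A \<noteq> {v}" for A
    using cuts[of A] that v by auto
  have sl: "2 * k + circ_norm k (sum b A) \<le> cut_degree m p q V A" if "A \<subseteq> V" "A \<noteq> V" "A \<noteq> {v}" "v \<in> A" for A
    using slack[OF ns] card_ge_2 that by blast
  show False
  proof (cases "\<exists>x\<in>V. 1 \<le> m v x")
    case True
    then obtain x where x: "x \<in> V" "1 \<le> m v x" by blast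
    then have vx: "v \<noteq> x" using m_diag[of v] by auto
    \<comment> \<open>Two distinct neighbours of \<open>v\<close> would allow a lift.\<close>
    have no2: "m v y = 0" if "y \<in> V" "y \<noteq> x" for y
    proof (rule ccontr)
      assume "m v y \<noteq> 0"
      then have "1 \<le> m v y" using m_nonneg[of v y] by simp
      moreover from this have "v \<noteq> y" using m_diag[of v] by auto
      ultimately show False
        using lift_edges[OF v(1) x(1) that(1) vx _ _ x(2) _ v(2)] slack[OF ns] sing ns that(2) by blast
    qed
    have pv: "p v = 0"
    proof (rule ccontr)
      assume "p v \<noteq> 0"
      then have "1 \<le> p v" using p_nonneg[of v] by simp
      \<comment> \<open>A path from \<open>x\<close> through \<open>v\<close> to the additional
        vertex is shortened to a pre-oriented edge leaving \<open>x\<close>.\<close>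
      define p' where "p' w = p w - of_bool (w = v) + of_bool (w = x)" for w
      have sp: "sum p' A = sum p A - of_bool (v \<in> A) + of_bool (x \<in> A)" if "A \<subseteq> V" for A
        unfolding p'_def using finite_sub[OF that] by (simp add: sum.distrib sum_subtractf sum_of_bool_point)
      have "mod_orientable k V m b p q"
      proof (rule delete_edge[where x = x and y = v and p' = p' and q' = q and b' = b and X' = "{v}"])
        show "x \<in> V" "v \<in> V" "x \<noteq> v" using x v vx by auto
        show "1 \<le> m x v" using x m_sym[of v x] by simp
        show "0 \<le> p' w" for w unfolding p'_def using p_nonneg[of w] \<open>1 \<le> p v\<close> by auto
        show "0 \<le> q w" for w by (rule q_nonneg)
        show "b w - p' w + q w = b w - p w + q w - of_bool (w = x) + of_bool (w = v)" for w
          unfolding p'_def by simp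
        show "sum p' V + sum q V \<le> 2 * k - 2 + circ_norm k (sum b V)" using tokens sp[of V] x v by simp
        show "{v} = {} \<or> (\<exists>w\<in>V. {v} = {w} \<and> 2 * k dvd b w)" using v by simp
        fix A assume A: "A \<subseteq> V" "A \<noteq> {}" "A \<noteq> V" "A \<noteq> {v}"
        have "cut_degree m p' q V A = cut_degree m p q V A - of_bool (v \<in> A) + of_bool (x \<in> A)"
          unfolding cut_degree_def using sp[OF A(1)] by simp
        then show "2 * k - 2 + circ_norm k (sum b A) + (of_bool (x \<in> A \<and> v \<notin> A) + of_bool (v \<in> A \<and> x \<notin> A))
            \<le> cut_degree m p' q V A"
          using ct[OF A] sl[OF A(1,3,4)] by (cases "v \<in> A"; cases "x \<in> A") auto
      qed
      then show False using ns by simp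
    qed
    have qv: "q v = 0"
    proof (rule ccontr)
      assume "q v \<noteq> 0"
      then have "1 \<le> q v" using q_nonneg[of v] by simp
      \<comment> \<open>The mirror image: a path from the additional vertex through \<open>v\<close>
        to \<open>x\<close> becomes a pre-oriented edge entering \<open>x\<close>.\<close>
      define q' where "q' w = q w - of_bool (w = v) + of_bool (w = x)" for w
      have sq: "sum q' A = sum q A - of_bool (v \<in> A) + of_bool (x \<in> A)" if "A \<subseteq> V" for A
        unfolding q'_def using finite_sub[OF that] by (simp add: sum.distrib sum_subtractf sum_of_bool_point)
      have "mod_orientable k V m b p q"
      proof (rule delete_edge[where x = v and y = x and p' = p and q' = q' and b' = b and X' = "{v}"])
        show "x \<in> V" "v \<in> V" "v \<noteq> x" "1 \<le> m v x" using x v vx by auto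
        show "0 \<le> q' w" for w unfolding q'_def using q_nonneg[of w] \<open>1 \<le> q v\<close> by auto
        show "0 \<le> p w" for w by (rule p_nonneg)
        show "b w - p w + q' w = b w - p w + q w - of_bool (w = v) + of_bool (w = x)" for w
          unfolding q'_def by simp
        show "sum p V + sum q' V \<le> 2 * k - 2 + circ_norm k (sum b V)" using tokens sq[of V] x v by simp
        show "{v} = {} \<or> (\<exists>w\<in>V. {v} = {w} \<and> 2 * k dvd b w)" using v by simp
        fix A assume A: "A \<subseteq> V" "A \<noteq> {}" "A \<noteq> V" "A \<noteq> {v}"
        have "cut_degree m p q' V A = cut_degree m p q V A - of_bool (v \<in> A) + of_bool (x \<in> A)"
          unfolding cut_degree_def using sq[OF A(1)] by simp
        then show "2 * k - 2 + circ_norm k (sum b A) + (of_bool (v \<in> A \<and> x \<notin> A) + of_bool (x \<in> A \<and> v \<notin> A))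
            \<le> cut_degree m p q' V A"
          using ct[OF A] sl[OF A(1,3,4)] by (cases "v \<in> A"; cases "x \<in> A") auto
      qed
      then show False using ns by simp
    qed
    show False using remove_vertex[OF v(1) x(1) vx no2 v(2) pv qv v(3)] ns by simp
  next
    case False
    then have iso: "m v u = 0" if "u \<in> V" for u using m_nonneg[of v u] that by force
    have "V \<noteq> {v}" using v(4) by auto
    then obtain x where x: "x \<in> V" "v \<noteq> x" using v(1) by blast
    \<comment> \<open>As \<open>v\<close> has no neighbour in \<open>V\<close>, any other vertex can
      play the part of \<open>x\<close> in \<open>remove_vertex\<close>.\<close>
    have "p v \<noteq> 0 \<or> q v \<noteq> 0" using remove_vertex[OF v(1) x iso v(2) _ _ v(3)] ns by blast
    then have tok: "1 \<le> p v + q v" using p_nonneg[of v] q_nonneg[of v] by linarith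
    \<comment> \<open>The cut around \<open>?A\<close> consists of the pre-oriented edges not at
      \<open>v\<close>. Their number is strictly below the bound in \<open>tokens\<close>, which
      equals the lower bound required of this cut because \<open>b v\<close> vanishes modulo
      \<open>2 * k\<close>.\<close>
    let ?A = "V - {v}"
    have VA: "V - ?A = {v}" using v(1) by auto
    have "m u v = 0" if "u \<in> V" for u using iso[OF that] m_sym[of u v] by simp
    then have "cut_degree m p q V ?A = sum p ?A + sum q ?A" unfolding cut_degree_def VA by simp
    moreover have s: "sum f V = f v + sum f ?A" for f :: "'v \<Rightarrow> int"
      using fin v(1) by (simp add: sum.remove)
    moreover have "circ_norm k (sum b ?A) = circ_norm k (sum b V)" using s[of b] v(2) by (intro circ_norm_cong) simp
    moreover have "2 * k - 2 + circ_norm k (sum b ?A) \<le> cut_degree m p q V ?A"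
      using ct[of ?A] x v(1) by blast
    ultimately show False using tok tokens s[of p] s[of q] by linarith
  qed
qed

text \<open>The edge is directed from \<open>x\<close> to \<open>y\<close> and deleted, and both
  demands move towards zero. For \<open>{x}\<close> and \<open>{y}\<close> the smaller norm pays for
  the lost edge; a larger set may lose an edge and gain one in norm, which uses up its slack of
  two.\<close>

lemma delete_opposite:
  assumes ns: "\<not> mod_orientable k V m b p q" and X: "X = {}" and xy: "x \<in> V" "y \<in> V" "1 \<le> m x y"
    and "circ_norm k (b x - 1) = circ_norm k (b x) - 1" "circ_norm k (b y + 1) = circ_norm k (b y) - 1"
  shows False
proof -
  define b' where "b' w = b w - of_bool (w = x) + of_bool (w = y)" for w
  have ne: "x \<noteq> y" using xy m_diag[of x] by auto
  have sb: "sum b' A = sum b A - of_bool (x \<in> A) + of_bool (y \<in> A)" if "A \<subseteq> V" for A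
    unfolding b'_def using finite_sub[OF that] by (simp add: sum.distrib sum_subtractf sum_of_bool_point)
  have "mod_orientable k V m b p q"
  proof (rule delete_edge[where x = x and y = y and p' = p and q' = q and b' = b' and X' = "{}"])
    show "x \<in> V" "y \<in> V" "x \<noteq> y" "1 \<le> m x y" by (fact xy ne)+
    show "0 \<le> p w" "0 \<le> q w" for w by (rule p_nonneg q_nonneg)+
    show "b' w - p w + q w = b w - p w + q w - of_bool (w = x) + of_bool (w = y)" for w
      unfolding b'_def by simp
    show "sum p V + sum q V \<le> 2 * k - 2 + circ_norm k (sum b' V)" using tokens sb[of V] xy by simp
    show "{} = {} \<or> (\<exists>w\<in>V. {} = {w} \<and> 2 * k dvd b' w)" by simp
    fix A assume A: "A \<subseteq> V" "A \<noteq> {}" "A \<noteq> V" "A \<noteq> {}"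
    have c: "2 * k - 2 + circ_norm k (sum b A) \<le> cut_degree m p q V A" using cuts A X by simp
    have l: "circ_norm k (sum b A - 1) \<le> circ_norm k (sum b A) + 1" "circ_norm k (sum b A + 1) \<le> circ_norm k (sum b A) + 1"
      using circ_norm_lip[OF k0, of "sum b A" "-1"] circ_norm_lip[OF k0, of "sum b A" 1] by auto
    show "2 * k - 2 + circ_norm k (sum b' A) + (of_bool (x \<in> A \<and> y \<notin> A) + of_bool (y \<in> A \<and> x \<notin> A)) \<le> cut_degree m p q V A"
    proof -
      consider "(x \<in> A) = (y \<in> A)" | "x \<in> A" "y \<notin> A" | "y \<in> A" "x \<notin> A" by blast
      then show ?thesis
      proof cases
        case 1
        then show ?thesis using c sb[OF A(1)] by auto
      next
        case 2
        then show ?thesis using c l sb[OF A(1)] assms(6) slack[OF ns A(1,3)] card_ge_2[OF A(1), of x]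
          by (cases "A = {x}") auto
      next
        case 3
        then show ?thesis using c l sb[OF A(1)] assms(7) slack[OF ns A(1,3)] card_ge_2[OF A(1), of y]
          by (cases "A = {y}") auto
      qed
    qed
  qed
  then show False using ns by simp
qed

text \<open>The cut conditions of \<open>A\<close> and its complement, compared with the bound on
  pre-oriented edges, leave at least \<open>2 * k - 2\<close> for twice the number of edges across,
  and this is positive.\<close>

lemma crossing_edge:
  assumes X: "X = {}" and A: "A \<subseteq> V" "A \<noteq> {}" "A \<noteq> V"
  obtains x y where "x \<in> A" "y \<in> V - A" "1 \<le> m x y"
proof -
  let ?B = "V - A"
  have VB: "V - ?B = A" using A by auto
  have B: "?B \<subseteq> V" "?B \<noteq> {}" "?B \<noteq> V" using A by auto
  have s: "sum f V = sum f ?B + sum f A" for f :: "'v \<Rightarrow> int" using A fin by (metis sum.subset_diff)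
  have "(\<Sum>u\<in>?B. \<Sum>v\<in>A. m u v) = (\<Sum>v\<in>A. \<Sum>u\<in>?B. m u v)" by (rule sum.swap)
  also have "\<dots> = (\<Sum>v\<in>A. \<Sum>u\<in>?B. m v u)" by (intro sum.cong refl m_sym)
  finally have "cut_degree m p q V A + cut_degree m p q V ?B = 2 * (\<Sum>v\<in>A. \<Sum>u\<in>?B. m v u) + (sum p V + sum q V)"
    unfolding cut_degree_def VB using s[of p] s[of q] by simp
  moreover have "circ_norm k (sum b V) \<le> circ_norm k (sum b A) + circ_norm k (sum b ?B)"
    using circ_norm_add[OF k0, of "sum b A" "sum b ?B"] s[of b] by (simp add: add.commute)
  ultimately have "(\<Sum>v\<in>A. \<Sum>u\<in>?B. m v u) > 0"
    using cuts[OF A] cuts[OF B] A B X tokens k2 by simp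
  moreover have "(\<Sum>v\<in>A. \<Sum>u\<in>?B. m v u) \<le> 0" if "\<And>x y. x \<in> A \<Longrightarrow> y \<in> ?B \<Longrightarrow> m x y \<le> 0"
    using that by (intro sum_nonpos)
  ultimately obtain x y where "x \<in> A" "y \<in> ?B" "0 < m x y" by fastforce
  then show ?thesis by (intro that[of x y]) simp_all
qed

text \<open>
  An oriented edge can be deleted as long as the demands at its ends move towards zero.  If all
  demands are positive, a deletion \<open>x \<rightarrow> y\<close> is compensated at \<open>y\<close> by a new pre-oriented edge into
  \<open>y\<close>, unless there are exactly \<open>2k - 1\<close> pre-oriented edges, all of them entering \<open>V\<close>.  In that
  case pre-oriented edges leaving \<open>x\<close> are added until the demand at \<open>x\<close> is \<open>k\<close>, which is both
  positive and negative, and then an edge \<open>y \<rightarrow> x\<close> can be deleted.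
\<close>

lemma all_positive:
  assumes ns: "\<not> mod_orientable k V m b p q" and X: "X = {}" and cV: "2 \<le> card V"
    and pos: "\<And>v. v \<in> V \<Longrightarrow> \<not> 2 * k dvd b v \<and> circ_norm k (b v + 1) \<noteq> circ_norm k (b v) - 1"
  shows False
proof -
  have dec: "circ_norm k (b v - 1) = circ_norm k (b v) - 1" if "v \<in> V" for v
    using circ_norm_dir[OF k0, of "b v"] pos[OF that] by blast
  have ct: "2 * k - 2 + circ_norm k (sum b A) \<le> cut_degree m p q V A" if "A \<subseteq> V" "A \<noteq> {}" "A \<noteq> V" for A
    using cuts that X by simp
  have dn: "circ_norm k (a - 1) \<le> circ_norm k a + 1" for a using circ_norm_lip[OF k0, of a "-1"] by simp
  \<comment> \<open>A pre-oriented edge leaving \<open>x\<close> is absorbed into the demand at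
    \<open>x\<close>, which moves towards zero while the net demand within \<open>V\<close> stays
    the same.\<close>
  have p0: "p x = 0" if x: "x \<in> V" for x
  proof (rule ccontr)
    assume "p x \<noteq> 0"
    then have px: "1 \<le> p x" using p_nonneg[of x] by simp
    define p' where "p' w = p w - of_bool (w = x)" for w
    define b' where "b' w = b w - of_bool (w = x)" for w
    have sp: "sum p' A = sum p A - of_bool (x \<in> A)" if "A \<subseteq> V" for A
      unfolding p'_def using finite_sub[OF that] by (simp add: sum_subtractf sum_of_bool_point)
    have sb: "sum b' A = sum b A - of_bool (x \<in> A)" if "A \<subseteq> V" for A
      unfolding b'_def using finite_sub[OF that] by (simp add: sum_subtractf sum_of_bool_point)
    have bp: "b' w - p' w = b w - p w" for w unfolding b'_def p'_def by simp
    have nrmV: "circ_norm k (sum b V) \<le> circ_norm k (sum b' V) + 1"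
      using circ_norm_lip[OF k0, of "sum b V - 1" 1] sb[of V] x by simp
    have S: "orientation_state k V m b' p' q {}"
    proof
      show "2 \<le> k" "finite V" by (rule k2 fin)+
      show "0 \<le> m u v" "m u v = m v u" "m v v = 0" for u v by (rule m_nonneg m_sym m_diag)+
      show "0 \<le> p' w" "0 \<le> q w" for w unfolding p'_def using px p_nonneg[of w] q_nonneg by auto
      show "2 * k dvd (\<Sum>v\<in>V. b' v - p' v + q v)" unfolding bp by (rule balance)
      show "even (b' v - p' v + q v + (\<Sum>u\<in>V. m v u))" if "v \<in> V" for v unfolding bp by (rule parity[OF that])
      show "sum p' V + sum q V \<le> 2 * k - 2 + circ_norm k (sum b' V)"
        using tokens nrmV sp[of V] x by simp
      show "{} = {} \<or> (\<exists>v\<in>V. {} = {v} \<and> 2 * k dvd b' v)" by simp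
      fix A assume A: "A \<subseteq> V" "A \<noteq> {}" "A \<noteq> V" "A \<noteq> {}"
      have "cut_degree m p' q V A = cut_degree m p q V A - of_bool (x \<in> A)" unfolding cut_degree_def using sp[OF A(1)] by simp
      then show "2 * k - 2 + circ_norm k (sum b' A) \<le> cut_degree m p' q V A"
        using ct[OF A(1-3)] slack[OF ns A(1,3)] card_ge_2[OF A(1), of x] sb[OF A(1)] dec[OF x] dn[of "sum b A"]
        by (cases "x \<in> A"; cases "A = {x}") auto
    qed
    have "0 \<le> sum p' V" "0 \<le> sum q V" using q_nonneg px p_nonneg unfolding p'_def by (auto intro!: sum_nonneg)
    then have "(state_size V m p' q, state_size V m p q) \<in> smaller"
      using sp[of V] x unfolding state_size_def by (simp add: nat_less_iff)
    from IH[OF S this] obtain f where f: "\<And>u v. u \<in> V \<Longrightarrow> v \<in> V \<Longrightarrow> 0 \<le> f u v \<and> f u v + f v u = m u v"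
      "\<And>v. v \<in> V \<Longrightarrow> 2 * k dvd (\<Sum>u\<in>V. f v u - f u v) + p' v - q v - b' v"
      unfolding mod_orientable_def by blast
    have "2 * k dvd (\<Sum>u\<in>V. f v u - f u v) + p v - q v - b v" if "v \<in> V" for v
    proof -
      have "(\<Sum>u\<in>V. f v u - f u v) + p v - q v - b v = (\<Sum>u\<in>V. f v u - f u v) + p' v - q v - b' v"
        using bp[of v] by linarith
      then show ?thesis using f(2)[OF that] by (simp only:)
    qed
    then have "mod_orientable k V m b p q" unfolding mod_orientable_def using f(1) by blast
    then show False using ns by simp
  qed
  have sp0: "sum p V = 0" using p0 by simp
  define Q where "Q = sum q V"
  have QV: "2 * k dvd sum b V + Q" using balance sp0 unfolding Q_def by (simp add: sum.distrib sum_subtractf)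
  \<comment> \<open>With no pre-oriented edge leaving \<open>V\<close>, balance makes the demand sum
    congruent to \<open>- Q\<close>.\<close>
  have nQ: "circ_norm k (sum b V + j) = circ_norm k (Q - j)" for j
  proof -
    have "circ_norm k (sum b V + j) = circ_norm k (- (Q - j))" using QV by (intro circ_norm_cong) (simp add: algebra_simps)
    then show ?thesis by (simp only: circ_norm_minus)
  qed
  have Q: "Q \<le> 2 * k - 2 + circ_norm k Q" using tokens sp0 nQ[of 0] unfolding Q_def by simp
  obtain v where v: "v \<in> V" using cV by (metis all_not_in_conv card.empty not_numeral_le_zero)
  have "{v} \<noteq> V" using cV by auto
  then obtain x y where "x \<in> {v}" "y \<in> V - {v}" "1 \<le> m x y" using crossing_edge[OF X, of "{v}"] v by auto
  then have xy: "x \<in> V" "y \<in> V" "x \<noteq> y" "1 \<le> m x y" "1 \<le> m y x" using v m_sym[of x y] by auto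
  show False
  \<comment> \<open>The condition is the bound on pre-oriented edges after one more has been created
    and the demand at \<open>x\<close> lowered by one.\<close>
  proof (cases "Q + 1 \<le> 2 * k - 2 + circ_norm k (Q + 1)")
    case True
    define q' where "q' w = q w + of_bool (w = y)" for w
    define b' where "b' w = b w - of_bool (w = x)" for w
    have sq: "sum q' A = sum q A + of_bool (y \<in> A)" if "A \<subseteq> V" for A
      unfolding q'_def using finite_sub[OF that] by (simp add: sum.distrib sum_of_bool_point)
    have sb: "sum b' A = sum b A - of_bool (x \<in> A)" if "A \<subseteq> V" for A
      unfolding b'_def using finite_sub[OF that] by (simp add: sum_subtractf sum_of_bool_point)
    have "mod_orientable k V m b p q"
    proof (rule delete_edge[where x = x and y = y and p' = p and q' = q' and b' = b' and X' = "{}"])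
      show "x \<in> V" "y \<in> V" "x \<noteq> y" "1 \<le> m x y" by (fact xy)+
      show "0 \<le> p w" "0 \<le> q' w" for w unfolding q'_def using p_nonneg q_nonneg by auto
      show "b' w - p w + q' w = b w - p w + q w - of_bool (w = x) + of_bool (w = y)" for w
        unfolding b'_def q'_def by simp
      show "sum p V + sum q' V \<le> 2 * k - 2 + circ_norm k (sum b' V)"
        using True nQ[of "-1"] sp0 sq[of V] sb[of V] xy unfolding Q_def by simp
      show "{} = {} \<or> (\<exists>w\<in>V. {} = {w} \<and> 2 * k dvd b' w)" by simp
      fix A assume A: "A \<subseteq> V" "A \<noteq> {}" "A \<noteq> V" "A \<noteq> {}"
      have d: "cut_degree m p q' V A = cut_degree m p q V A + of_bool (y \<in> A)" unfolding cut_degree_def using sq[OF A(1)] by simp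
      show "2 * k - 2 + circ_norm k (sum b' A) + (of_bool (x \<in> A \<and> y \<notin> A) + of_bool (y \<in> A \<and> x \<notin> A)) \<le> cut_degree m p q' V A"
        using ct[OF A(1-3)] slack[OF ns A(1,3)] card_ge_2[OF A(1), of x] dec[OF xy(1)] dn[of "sum b A"]
        unfolding d sb[OF A(1)]
        by (cases "x \<in> A"; cases "y \<in> A"; cases "A = {x}") auto
    qed
    then show False using ns by simp
  next
    case False
    have s: "circ_norm k (Q + 1) = circ_norm k Q - 1" using circ_norm_step[OF k0, of Q] False Q by linarith
    \<comment> \<open>Since \<open>Q\<close> and its norm have the same parity, the bound on
      \<open>Q\<close> is attained. As \<open>Q\<close> is also congruent to minus its norm,
      \<open>2 * k\<close> divides twice the norm minus 2, which forces the norm to be 1.\<close>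
    have "even (circ_norm k Q) = even Q" using circ_norm_even[OF k0] by blast
    then have "Q \<noteq> 2 * k - 3 + circ_norm k Q" by (metis even_add even_diff odd_numeral even_mult_iff even_numeral)
    then have Qs: "Q = 2 * k - 2 + circ_norm k Q" using False Q s by linarith
    have s1: "1 \<le> circ_norm k Q" "circ_norm k Q \<le> k" using s circ_norm_nonneg[OF k0, of "Q + 1"] circ_norm_le_k[OF k0] by auto
    have "2 * k dvd Q + circ_norm k Q" using circ_norm_neg_rep[OF k0 s] .
    moreover have "Q + circ_norm k Q = 2 * k + (2 * circ_norm k Q - 2)" using Qs by linarith
    ultimately have "2 * k dvd 2 * circ_norm k Q - 2" by simp
    then have "circ_norm k Q = 1" using s1 zdvd_not_zless[of "2 * circ_norm k Q - 2" "2 * k"] by force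
    then have Q1: "Q = 2 * k - 1" using Qs by simp
    define t where "t = circ_norm k (b x)"
    obtain z where z: "b x = 2 * k * z + t" "t < k"
      using circ_norm_pos_rep[OF k0, of "b x"] pos[OF xy(1)] unfolding t_def by blast
    have t1: "1 \<le> t" using dec[OF xy(1)] circ_norm_nonneg[OF k0, of "b x - 1"] unfolding t_def by linarith
    \<comment> \<open>The \<open>k - t\<close> new edges raise the demand at \<open>x\<close> from
      \<open>t\<close> to \<open>k\<close> modulo \<open>2 * k\<close>, and deleting the arc from
      \<open>y\<close> to \<open>x\<close> raises it to \<open>k + 1\<close>, which has norm
      \<open>k - 1\<close>.\<close>
    define p' where "p' w = p w + (k - t) * of_bool (w = x)" for w
    define b' where "b' w = b w + (k - t + 1) * of_bool (w = x) - of_bool (w = y)" for w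
    have sp: "sum p' A = sum p A + (k - t) * of_bool (x \<in> A)" if "A \<subseteq> V" for A
      unfolding p'_def using that by (simp add: sum.distrib sum_scaled_of_bool)
    have sb: "sum b' A = sum b A + (k - t + 1) * of_bool (x \<in> A) - of_bool (y \<in> A)" if "A \<subseteq> V" for A
      unfolding b'_def using sum_scaled_of_bool[OF that, of 1 y] that by (simp add: sum.distrib sum_subtractf sum_scaled_of_bool)
    have "mod_orientable k V m b p q"
    proof (rule delete_edge[where x = y and y = x and p' = p' and q' = q and b' = b' and X' = "{}"])
      show "y \<in> V" "x \<in> V" "y \<noteq> x" "1 \<le> m y x" using xy by auto
      show "0 \<le> p' w" "0 \<le> q w" for w unfolding p'_def using p_nonneg[of w] q_nonneg z by auto
      show "b' w - p' w + q w = b w - p w + q w - of_bool (w = y) + of_bool (w = x)" for w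
        unfolding b'_def p'_def by (simp add: algebra_simps)
      \<comment> \<open>The demand sum, congruent to 1 before, is now congruent to
        \<open>1 + k - t\<close>, and the bound on pre-oriented edges holds with equality.\<close>
      obtain c where "sum b V + Q = 2 * k * c" using QV by (rule dvdE)
      then have "sum b' V = 2 * k * (c - 1) + (1 + k - t)"
        using sb[of V] xy Q1 by (simp add: algebra_simps)
      then have "circ_norm k (sum b' V) = 1 + k - t" using circ_norm_eq[OF k0, of "1 + k - t" "c - 1"] t1 z by simp
      then show "sum p' V + sum q V \<le> 2 * k - 2 + circ_norm k (sum b' V)"
        using sp[of V] sp0 xy Q1 unfolding Q_def by simp
      show "{} = {} \<or> (\<exists>w\<in>V. {} = {w} \<and> 2 * k dvd b' w)" by simp
      fix A assume A: "A \<subseteq> V" "A \<noteq> {}" "A \<noteq> V" "A \<noteq> {}"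
      have d: "cut_degree m p' q V A = cut_degree m p q V A + (k - t) * of_bool (x \<in> A)" unfolding cut_degree_def using sp[OF A(1)] by simp
      have l: "circ_norm k (sum b A + (k - t + 1)) \<le> circ_norm k (sum b A) + (k - t + 1)"
        "circ_norm k (sum b A + (k - t)) \<le> circ_norm k (sum b A) + (k - t)"
        using circ_norm_lip[OF k0, of "sum b A" "k - t + 1"] circ_norm_lip[OF k0, of "sum b A" "k - t"] z by auto
      show "2 * k - 2 + circ_norm k (sum b' A) + (of_bool (y \<in> A \<and> x \<notin> A) + of_bool (x \<in> A \<and> y \<notin> A)) \<le> cut_degree m p' q V A"
      proof (cases "x \<in> A")
        case False
        then show ?thesis
          using ct[OF A(1-3)] slack[OF ns A(1,3)] card_ge_2[OF A(1), of y] dec[OF xy(2)] dn[of "sum b A"]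
          unfolding d sb[OF A(1)] by (cases "y \<in> A"; cases "A = {y}") auto
      next
        case True
        show ?thesis
        proof (cases "y \<in> A")
          case yA: True
          have "circ_norm k (sum b' A) \<le> circ_norm k (sum b A) + (k - t)" using l(2) sb[OF A(1)] True yA by simp
          then show ?thesis using ct[OF A(1-3)] True yA unfolding d by simp
        next
          case yA: False
          show ?thesis
          proof (cases "A = {x}")
            case Ax: True
            have "sum b' A = 2 * k * (z + 1) + (1 - k)"
              using z sb[OF A(1)] yA unfolding Ax by (simp add: algebra_simps)
            then have "circ_norm k (sum b' A) \<le> k - 1" using circ_norm_le[OF k0, of "z + 1" "1 - k"] k2 by simp
            then show ?thesis using ct[OF A(1-3)] True yA unfolding d by (simp add: Ax t_def)
          next
            case False
            have "circ_norm k (sum b' A) \<le> circ_norm k (sum b A) + (k - t + 1)" using l(1) sb[OF A(1)] True yA by simp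
            then show ?thesis
              using slack[OF ns A(1,3)] card_ge_2[OF A(1) True False] True yA unfolding d by simp
          qed
        qed
      qed
    qed
    then show False using ns by simp
  qed
qed

text \<open>Reversing all arcs negates the demands and exchanges \<open>p\<close> and
  \<open>q\<close>, so negative demands reduce to positive ones.\<close>

lemma reverse: "induction_state k V m (\<lambda>v. - b v) q p X"
proof
  show "2 \<le> k" "finite V" by (rule k2 fin)+
  show "0 \<le> m u v" "m u v = m v u" "m v v = 0" for u v by (rule m_nonneg m_sym m_diag)+
  show "0 \<le> p v" "0 \<le> q v" for v by (rule p_nonneg q_nonneg)+
  have "(\<Sum>v\<in>V. - b v - q v + p v) = - (\<Sum>v\<in>V. b v - p v + q v)"
    by (simp add: sum_negf sum.distrib sum_subtractf)
  then show "2 * k dvd (\<Sum>v\<in>V. - b v - q v + p v)" using balance by simp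
  show "even (- b v - q v + p v + (\<Sum>u\<in>V. m v u))" if "v \<in> V" for v using parity[OF that] by auto
  show "sum q V + sum p V \<le> 2 * k - 2 + circ_norm k (\<Sum>v\<in>V. - b v)" using tokens by (simp add: sum_negf)
  show "X = {} \<or> (\<exists>v\<in>V. X = {v} \<and> 2 * k dvd - b v)" using exempt by simp
  show "2 * k - 2 + circ_norm k (\<Sum>v\<in>A. - b v) \<le> cut_degree m q p V A" if "A \<subseteq> V" "A \<noteq> {}" "A \<noteq> V" "A \<noteq> X" for A
    using cuts[OF that] by (simp add: sum_negf cut_degree_def)
  show "mod_orientable k V' m' b' p' q'"
    if "orientation_state k V' m' b' p' q' X'" "(state_size V' m' p' q', state_size V m q p) \<in> smaller"
    for V' :: "'v set" and m' b' p' q' X'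
    using IH[OF that(1)] that(2) by (simp add: state_size_def add.commute)
qed

section \<open>Completing the induction\<close>

lemma mod_orientable_step: "mod_orientable k V m b p q"
proof (rule ccontr)
  assume ns: "\<not> mod_orientable k V m b p q"
  show False
  proof (cases "card V \<le> 1")
    case True
    have "mod_orientable k V m b p q"
    proof (cases "V = {}")
      case True
      then show ?thesis unfolding mod_orientable_def by simp
    next
      case False
      then have "card V = 1" using True fin by (simp add: le_Suc_eq)
      then obtain v where V: "V = {v}" by (metis card_1_singletonE)
      have "2 * k dvd - (b v - p v + q v)" using balance unfolding V by (simp only: dvd_minus_iff) simp
      then have "2 * k dvd p v - q v - b v" by (simp add: algebra_simps)
      then show ?thesis unfolding mod_orientable_def V using m_diag by (intro exI[of _ "\<lambda>_ _. 0"]) simp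
    qed
    then show False using ns by simp
  next
    case False
    then have cV: "2 \<le> card V" by simp
    have X: "X = {}" using exempt zero_vertex[OF _ _ _ cV] ns by blast
    have nz: "\<not> 2 * k dvd b v" if "v \<in> V" for v using zero_vertex[OF that _ _ cV] X ns by blast
    \<comment> \<open>For nonzero demands, \<open>P\<close> means strictly between a multiple of
      \<open>2 * k\<close> and the midpoint above it, and \<open>N\<close> strictly between a
      midpoint and the multiple above it. A demand congruent to \<open>k\<close> satisfies
      neither.\<close>
    define P where "P v \<longleftrightarrow> circ_norm k (b v + 1) \<noteq> circ_norm k (b v) - 1" for v
    define N where "N v \<longleftrightarrow> circ_norm k (b v - 1) \<noteq> circ_norm k (b v) - 1" for v
    have PN: "\<not> (P v \<and> N v)" if "v \<in> V" for v using circ_norm_dir[OF k0 nz[OF that]] unfolding P_def N_def by blast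
    \<comment> \<open>Otherwise the edge could be deleted in one of its two directions.\<close>
    have edge: "P x \<and> P y \<or> N x \<and> N y" if "x \<in> V" "y \<in> V" "1 \<le> m x y" for x y
      using delete_opposite[OF ns X that] delete_opposite[OF ns X that(2,1)] that m_sym[of x y] PN
      unfolding P_def N_def by metis
    define A where "A = {v \<in> V. P v}"
    \<comment> \<open>Every cut is crossed by an edge, and edges only join demands of the same
      sign.\<close>
    have "A = {} \<or> A = V"
    proof (rule ccontr)
      assume "\<not> ?thesis"
      then obtain x y where "x \<in> A" "y \<in> V - A" "1 \<le> m x y"
        using crossing_edge[OF X, of A] unfolding A_def by blast
      then show False using edge[of x y] PN unfolding A_def by blast
    qed
    then show False
    proof
      assume "A = V"
      then show False using all_positive[OF ns X cV] nz unfolding A_def P_def by blast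
    next
      assume A: "A = {}"
      have N: "N v" if v: "v \<in> V" for v
      proof -
        have "{v} \<noteq> V" using cV by auto
        then obtain x y where "x \<in> {v}" "y \<in> V - {v}" "1 \<le> m x y"
          using crossing_edge[OF X, of "{v}"] v by blast
        then show ?thesis using edge[of x y] A v unfolding A_def by blast
      qed
      interpret r: induction_state k V m "\<lambda>v. - b v" q p X by (rule reverse)
      have "\<not> mod_orientable k V m (\<lambda>v. - b v) q p"
      proof
        assume "mod_orientable k V m (\<lambda>v. - b v) q p"
        then obtain f where f: "\<And>u v. u \<in> V \<Longrightarrow> v \<in> V \<Longrightarrow> 0 \<le> f u v \<and> f u v + f v u = m u v"
          "\<And>v. v \<in> V \<Longrightarrow> 2 * k dvd (\<Sum>u\<in>V. f v u - f u v) + q v - p v - (- b v)"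
          unfolding mod_orientable_def by blast
        have "2 * k dvd (\<Sum>u\<in>V. f u v - f v u) + p v - q v - b v" if "v \<in> V" for v
        proof -
          have "(\<Sum>u\<in>V. f u v - f v u) + p v - q v - b v = - ((\<Sum>u\<in>V. f v u - f u v) + q v - p v - (- b v))"
            by (simp add: sum_subtractf)
          then show ?thesis using f(2)[OF that] by (simp only: dvd_minus_iff)
        qed
        moreover have "0 \<le> f v u \<and> f v u + f u v = m u v" if "u \<in> V" "v \<in> V" for u v
          using f(1)[OF that] f(1)[OF that(2,1)] by linarith
        ultimately have "mod_orientable k V m b p q" unfolding mod_orientable_def
          by (intro exI[of _ "\<lambda>u v. f v u"]) auto
        then show False using ns by simp
      qed
      moreover have "\<not> 2 * k dvd - b v \<and> circ_norm k (- b v + 1) \<noteq> circ_norm k (- b v) - 1" if "v \<in> V" for v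
      proof -
        have "circ_norm k (- b v + 1) = circ_norm k (b v - 1)" using circ_norm_minus[of k "b v - 1"] by simp
        then show ?thesis using N[OF that] nz[OF that] unfolding N_def by simp
      qed
      ultimately show False using r.all_positive[OF _ X cV] by blast
    qed
  qed
qed

end

theorem orientation_state_mod_orientable:
  assumes "orientation_state k V m b p q X"
  shows "mod_orientable k V m b p q"
proof -
  have "wf smaller" by (intro wf_lex_prod wf_less_than)
  then show ?thesis using assms
  proof (induction "state_size V m p q" arbitrary: V m b p q X rule: wf_induct_rule)
    case less
    interpret orientation_state k V m b p q X by (rule less.prems)
    interpret induction_state k V m b p q X
    proof
      fix V' :: "'a set" and m' b' p' q' X'
      assume "orientation_state k V' m' b' p' q' X'" "(state_size V' m' p' q', state_size V m p q) \<in> smaller"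
      then show "mod_orientable k V' m' b' p' q'" using less.hyps by blast
    qed
    show ?case by (rule mod_orientable_step)
  qed
qed

section \<open>Factors of bipartite graphs modulo 5\<close>

lemma sum_of_bool_card:
  assumes "finite V" shows "(\<Sum>u\<in>V. of_bool (P u)) = int (card {u \<in> V. P u})"
proof -
  have "(\<Sum>u\<in>V. of_bool (P u)) = (\<Sum>u | u \<in> V \<and> P u. 1 :: int)"
    unfolding of_bool_def using assms by (simp only: sum.inter_filter)
  then show ?thesis by simp
qed

section \<open>Vertex degrees and edge cuts\<close>

context finite_simple_graph
begin

lemma finite_edges: "finite E"
  using edges finite_verts by (meson Pow_iff finite_Pow_iff finite_subset subsetI)

lemma vdegree_neighbours:
  assumes "E' \<subseteq> E"
  shows "vdegree E' v = card {u \<in> V. {v, u} \<in> E'}"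
proof -
  have "(\<lambda>u. {v, u}) ` {u \<in> V. {v, u} \<in> E'} = {e \<in> E'. v \<in> e}"
  proof (intro equalityI subsetI)
    fix e assume "e \<in> {e \<in> E'. v \<in> e}"
    then have e: "e \<in> E'" "v \<in> e" "e \<subseteq> V" "card e = 2" using edges assms by auto
    obtain x y where xy: "e = {x, y}" using e(4) by (meson card_2_iff)
    have "\<exists>u. e = {v, u}" using e(2) unfolding xy by blast
    then obtain u where u: "e = {v, u}" by blast
    then have "u \<in> V" using e(3) by blast
    then show "e \<in> (\<lambda>u. {v, u}) ` {u \<in> V. {v, u} \<in> E'}" using e(1) unfolding u by (intro imageI) simp
  qed blast
  moreover have "inj_on (\<lambda>u. {v, u}) {u \<in> V. {v, u} \<in> E'}"
    by (intro inj_onI) (metis doubleton_eq_iff)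
  from card_image[OF this] have "card ((\<lambda>u. {v, u}) ` {u \<in> V. {v, u} \<in> E'}) = card {u \<in> V. {v, u} \<in> E'}" .
  ultimately show ?thesis unfolding vdegree_def by (simp only:)
qed

definition adj :: "'a \<Rightarrow> 'a \<Rightarrow> int" where
  "adj u v = of_bool ({u, v} \<in> E)"

lemma adj_simps: "0 \<le> adj u v" "adj u v = adj v u" "adj v v = 0"
  using edges[of "{v}"] by (auto simp: adj_def insert_commute)

lemma vdegree_adj: "int (vdegree E v) = (\<Sum>u\<in>V. adj v u)"
  unfolding adj_def sum_of_bool_card[OF finite_verts] using vdegree_neighbours[of E v] by simp

text \<open>Once all edges between \<open>S\<close> and its complement are removed, a path starting
  in \<open>S\<close> cannot leave it, so fewer than \<open>k\<close> such edges would contradict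
  edge-connectivity.\<close>

lemma edge_cut_ge:
  assumes "edge_connected k V E" and S: "S \<subseteq> V" "S \<noteq> {}" "S \<noteq> V"
  shows "int k \<le> (\<Sum>u\<in>S. \<Sum>v\<in>V - S. adj u v)"
proof -
  define P where "P = {(u, v) \<in> S \<times> (V - S). {u, v} \<in> E}"
  define F where "F = (\<lambda>(u, v). {u, v}) ` P"
  have fP: "finite P" unfolding P_def
    by (rule finite_subset[of _ "V \<times> V"]) (use S finite_verts in auto)
  obtain s t where st: "s \<in> S" "t \<in> V - S" using S by blast
  have "\<not> connected_graph V (E - F)"
  proof
    assume "connected_graph V (E - F)"
    then have "(s, t) \<in> {(x, y). {x, y} \<in> E - F}\<^sup>*" using st S unfolding connected_graph_def by blast
    then have "t \<in> S"
    proof induction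
      case (step y z)
      then have e: "{y, z} \<in> E" "{y, z} \<notin> F" by auto
      then have "z \<in> V" using edges by blast
      then show ?case using e step.IH unfolding F_def P_def by force
    qed (use st in simp)
    then show False using st by simp
  qed
  moreover have "F \<subseteq> E" unfolding F_def P_def by auto
  ultimately have "\<not> card F < k" using assms(1) unfolding edge_connected_def by blast
  then have "k \<le> card F" by simp
  also have "\<dots> \<le> card P" unfolding F_def using fP by (rule card_image_le)
  also have "int (card P) = (\<Sum>u\<in>S. \<Sum>v\<in>V - S. adj u v)"
  proof -
    have fS: "finite S" "finite (V - S)" using S finite_verts finite_subset by auto
    have "(\<Sum>u\<in>S. \<Sum>v\<in>V - S. adj u v) = (\<Sum>z\<in>S \<times> (V - S). of_bool (z \<in> P))"
      unfolding sum.cartesian_product by (intro sum.cong) (auto simp: adj_def P_def)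
    also have "\<dots> = int (card {z \<in> S \<times> (V - S). z \<in> P})"
      using fS by (intro sum_of_bool_card) simp
    also have "{z \<in> S \<times> (V - S). z \<in> P} = P" unfolding P_def by auto
    finally show ?thesis by simp
  qed
  finally show ?thesis by simp
qed

end

section \<open>Admissible degrees of \<open>H\<close> modulo 5\<close>

definition residue_A :: "int \<Rightarrow> bool \<Rightarrow> int" where
  "residue_A e w = (if e = 1 \<or> e = 3 then 1 else if e = 0 then of_bool w else 0)"

text \<open>Here and in \<open>residue_A\<close>, \<open>e\<close> is the vertex degree minus
  \<open>r\<close> modulo 5, so \<open>e\<close> minus the entry is the shifted degree in the
  complement. The flag \<open>w\<close> of \<open>residue_A\<close> selects between the two values
  possible for \<open>e = 0\<close> on \<open>A\<close>.\<close>

definition residue_B :: "int \<Rightarrow> int" where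
  "residue_B e = (if e = 0 \<or> e = 3 then 2 else if e = 1 \<or> e = 4 then 3 else 4)"

lemma mod_5_cases: "(e :: int) mod 5 \<in> {0, 1, 2, 3, 4}"
proof -
  have "e mod 5 = 0 \<or> e mod 5 = 1 \<or> e mod 5 = 2 \<or> e mod 5 = 3 \<or> e mod 5 = 4" by presburger
  then show ?thesis by simp
qed

lemma diff_mod_5: "(d - x - r) mod 5 = ((d - r) mod 5 - x mod 5) mod (5::int)"
proof -
  have "(d - x - r) mod 5 = ((d - r) - x) mod 5" by (simp add: diff_right_commute)
  also have "\<dots> = ((d - r) mod 5 - x mod 5) mod 5" by (simp only: mod_diff_eq)
  finally show ?thesis .
qed

lemma residue_A:
  assumes "x mod 5 = residue_A ((d - r) mod 5) w mod 5"
  shows "x mod 5 \<in> {0, 1} \<and> (d - x - r) mod 5 \<in> {0, 2, 4}"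
proof -
  have "residue_A e w mod 5 \<in> {0, 1} \<and> (e - residue_A e w mod 5) mod 5 \<in> {0, 2, 4}"
    if "e \<in> {0, 1, 2, 3, 4}" for e
    using that by (cases w) (auto simp: residue_A_def)
  then show ?thesis unfolding diff_mod_5 assms using mod_5_cases by blast
qed

lemma residue_B:
  assumes "x mod 5 = residue_B ((d - r) mod 5) mod 5"
  shows "x mod 5 \<in> {2, 3, 4} \<and> (d - x - r) mod 5 \<in> {1, 3}"
proof -
  have "residue_B e mod 5 \<in> {2, 3, 4} \<and> (e - residue_B e mod 5) mod 5 \<in> {1, 3}"
    if "e \<in> {0, 1, 2, 3, 4}" for e
    using that by (auto simp: residue_B_def)
  then show ?thesis unfolding diff_mod_5 assms using mod_5_cases by blast
qed

text \<open>Five residue classes with at most three elements each would cover only 15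
  elements.\<close>

lemma pigeonhole_mod_5:
  fixes d :: "'v \<Rightarrow> int"
  assumes "finite A" "16 \<le> card A"
  obtains r where "4 \<le> card {a \<in> A. (d a - r) mod 5 = 0}"
proof -
  have "\<exists>r\<in>{0..4}. 4 \<le> card {a \<in> A. (d a - r) mod 5 = 0}"
  proof (rule ccontr)
    assume "\<not> ?thesis"
    then have "card {a \<in> A. (d a - r) mod 5 = 0} \<le> 3" if "r \<in> {0..4}" for r using that by force
    then have "(\<Sum>r\<in>{0..4::int}. card {a \<in> A. (d a - r) mod 5 = 0}) \<le> (\<Sum>r\<in>{0..4::int}. 3)"
      by (intro sum_mono) auto
    moreover have "card (\<Union>r\<in>{0..4::int}. {a \<in> A. (d a - r) mod 5 = 0})
        \<le> (\<Sum>r\<in>{0..4::int}. card {a \<in> A. (d a - r) mod 5 = 0})"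
      by (rule card_UN_le) simp
    moreover have "A \<subseteq> (\<Union>r\<in>{0..4::int}. {a \<in> A. (d a - r) mod 5 = 0})"
    proof
      fix a assume "a \<in> A"
      moreover have "d a mod 5 \<in> {0..4}" "(d a - d a mod 5) mod 5 = 0" by (auto simp: mod_simps)
      ultimately show "a \<in> (\<Union>r\<in>{0..4::int}. {a \<in> A. (d a - r) mod 5 = 0})"
        by (intro UN_I[of "d a mod 5"]) simp_all
    qed
    then have "card A \<le> card (\<Union>r\<in>{0..4::int}. {a \<in> A. (d a - r) mod 5 = 0})"
      using assms(1) by (intro card_mono) auto
    ultimately show False using assms(2) by simp
  qed
  then show ?thesis using that by blast
qed

text \<open>\<open>H\<close> consists of the edges directed from \<open>A\<close> to
  \<open>B\<close> in an orientation with prescribed net out-degrees modulo 10. The condition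
  \<open>bal\<close> makes the total demand vanish modulo 10.\<close>

lemma (in finite_simple_graph) factor_mod_5:
  assumes AB: "A \<union> B = V" "A \<inter> B = {}" and bip: "\<And>e. e \<in> E \<Longrightarrow> \<exists>a\<in>A. \<exists>b\<in>B. e = {a, b}"
    and conn: "edge_connected 13 V E" and bal: "5 dvd sum g A - sum g B"
  obtains H where "H \<subseteq> E" "\<And>v. v \<in> V \<Longrightarrow> int (vdegree H v) mod 5 = g v mod 5"
proof -
  define d where "d v = int (vdegree E v)" for v
  have d: "d v = (\<Sum>u\<in>V. adj v u)" for v unfolding d_def by (rule vdegree_adj)
  \<comment> \<open>With \<open>g v\<close> outgoing edges a vertex of \<open>A\<close> has net
    out-degree \<open>g v - (d v - g v)\<close>. On \<open>B\<close> the edges of \<open>H\<close>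
    come in, which reverses the sign.\<close>
  define b where "b v = (if v \<in> A then 2 * g v - d v else d v - 2 * g v)" for v
  have fAB: "finite A" "finite B" using AB finite_verts by auto
  have sumAB: "sum h V = sum h A + sum h B" for h :: "'a \<Rightarrow> int"
    unfolding AB(1)[symmetric] using fAB AB(2) by (rule sum.union_disjoint)
  have no: "adj u v = 0" if "u \<in> A \<and> v \<in> A \<or> u \<in> B \<and> v \<in> B" for u v
    using bip[of "{u, v}"] that AB(2) by (auto simp: adj_def doubleton_eq_iff)
  have dA: "d v = (\<Sum>u\<in>B. adj v u)" if "v \<in> A" for v using that no by (simp add: d sumAB)
  have dB: "d v = (\<Sum>u\<in>A. adj v u)" if "v \<in> B" for v using that no by (simp add: d sumAB)
  have "sum d B = (\<Sum>v\<in>B. \<Sum>u\<in>A. adj v u)" using dB by simp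
  also have "\<dots> = (\<Sum>u\<in>A. \<Sum>v\<in>B. adj v u)" by (rule sum.swap)
  also have "\<dots> = (\<Sum>u\<in>A. \<Sum>v\<in>B. adj u v)" by (intro sum.cong refl adj_simps)
  also have "\<dots> = sum d A" using dA by simp
  finally have cut_degree: "sum d B = sum d A" .
  have bB: "b v = d v - 2 * g v" if "v \<in> B" for v using that AB(2) by (auto simp: b_def)
  have "sum b V = (\<Sum>v\<in>A. 2 * g v - d v) + (\<Sum>v\<in>B. d v - 2 * g v)"
    unfolding sumAB using bB by (simp add: b_def)
  also have "\<dots> = 2 * (sum g A - sum g B)" using cut_degree by (simp add: sum_subtractf sum_distrib_left[symmetric])
  finally have sb: "sum b V = 2 * (sum g A - sum g B)" .
  obtain c where "sum g A - sum g B = 5 * c" using bal by (rule dvdE)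
  then have sbc: "sum b V = 2 * 5 * c" using sb by simp
  define z where "z v = (0 :: int)" for v :: 'a
  have "orientation_state 5 V adj b z z {}"
  proof
    show "(2::int) \<le> 5" "finite V" by (simp_all add: finite_verts)
    show "0 \<le> adj u v" "adj u v = adj v u" "adj v v = 0" for u v by (rule adj_simps)+
    show "0 \<le> z v" for v by (simp add: z_def)
    show "2 * 5 dvd (\<Sum>v\<in>V. b v - z v + z v)" using sbc by (simp add: z_def)
    show "even (b v - z v + z v + (\<Sum>u\<in>V. adj v u))" for v by (simp add: b_def d)
    show "sum z V + sum z V \<le> 2 * 5 - 2 + circ_norm 5 (sum b V)"
      using circ_norm_nonneg[of 5 "sum b V"] by (simp add: z_def)
    show "{} = {} \<or> (\<exists>v\<in>V. {} = {v} \<and> 2 * 5 dvd b v)" by simp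
    \<comment> \<open>The norm is at most 5, so the left side is at most 13, the assumed
      edge-connectivity.\<close>
    show "2 * 5 - 2 + circ_norm 5 (sum b S) \<le> cut_degree adj z z V S"
      if "S \<subseteq> V" "S \<noteq> {}" "S \<noteq> V" for S
      using edge_cut_ge[OF conn that] circ_norm_le_k[of 5 "sum b S"] by (simp add: cut_degree_def z_def)
  qed
  from orientation_state_mod_orientable[OF this] obtain f where
    f: "\<And>u v. u \<in> V \<Longrightarrow> v \<in> V \<Longrightarrow> 0 \<le> f u v \<and> f u v + f v u = adj u v"
      "\<And>v. v \<in> V \<Longrightarrow> 2 * 5 dvd (\<Sum>u\<in>V. f v u - f u v) + z v - z v - b v"
    unfolding mod_orientable_def by blast
  have f_le: "0 \<le> f u v \<and> f u v \<le> adj u v" if "u \<in> V" "v \<in> V" for u v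
    using f(1)[OF that] f(1)[OF that(2,1)] by linarith
  have f01: "f u v \<in> {0, 1}" if "u \<in> V" "v \<in> V" for u v
  proof -
    have "adj u v \<le> 1" by (simp add: adj_def)
    then have "f u v = 0 \<or> f u v = 1" using f_le[OF that] by linarith
    then show ?thesis by simp
  qed
  have f1: "{u, v} \<in> E" if "u \<in> V" "v \<in> V" "f u v = 1" for u v
  proof (rule ccontr)
    assume "{u, v} \<notin> E"
    then show False using f_le[OF that(1,2)] that(3) by (simp add: adj_def)
  qed
  define H where "H = {{x, y} | x y. x \<in> A \<and> y \<in> B \<and> f x y = 1}"
  have HE: "H \<subseteq> E" unfolding H_def using f1 AB(1) by blast
  have A_H: "{x, y} \<in> H \<longleftrightarrow> f x y = 1" if "x \<in> A" "y \<in> V" for x y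
  proof
    assume "{x, y} \<in> H"
    then obtain a b where ab: "{x, y} = {a, b}" "a \<in> A" "b \<in> B" "f a b = 1" unfolding H_def by blast
    have "x = a \<and> y = b \<or> x = b \<and> y = a" using ab(1) by (simp only: doubleton_eq_iff)
    moreover have "x \<noteq> b" using that(1) ab(3) AB(2) by blast
    ultimately show "f x y = 1" using ab(4) by blast
  next
    assume 1: "f x y = 1"
    have "{x, y} \<in> E" using f1 1 that AB(1) by blast
    then obtain a b where ab: "{x, y} = {a, b}" "a \<in> A" "b \<in> B" using bip by blast
    have "x = a \<and> y = b \<or> x = b \<and> y = a" using ab(1) by (simp only: doubleton_eq_iff)
    moreover have "x \<noteq> b" using that(1) ab(3) AB(2) by blast
    ultimately have "y \<in> B" using ab(3) by blast
    then show "{x, y} \<in> H" unfolding H_def using that(1) 1 by blast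
  qed
  have B_H: "{x, y} \<in> H \<longleftrightarrow> f y x = 1" if "x \<in> B" "y \<in> V" for x y
  proof (cases "y \<in> A")
    case True
    moreover have "x \<in> V" using that(1) AB(1) by blast
    ultimately show ?thesis using A_H[of y x] by (simp add: insert_commute)
  next
    case False
    then have "y \<in> B" using that AB(1) by blast
    then have "adj y x = 0" using no that by blast
    then have "{y, x} \<notin> E" by (simp add: adj_def)
    moreover have "{x, y} = {y, x}" by blast
    ultimately show ?thesis using f1[of y x] HE that AB(1) by auto
  qed
  have count: "(\<Sum>u\<in>V. h u) = int (card {u \<in> V. h u = 1})" if "\<And>u. u \<in> V \<Longrightarrow> h u \<in> {0, 1}" for h :: "'a \<Rightarrow> int"
  proof -
    have "(\<Sum>u\<in>V. h u) = (\<Sum>u\<in>V. of_bool (h u = 1))" using that by (intro sum.cong) auto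
    then show ?thesis unfolding sum_of_bool_card[OF finite_verts] .
  qed
  have "int (vdegree H v) mod 5 = g v mod 5" if v: "v \<in> V" for v
  proof -
    have tot: "(\<Sum>u\<in>V. f v u) + (\<Sum>u\<in>V. f u v) = d v"
      using f(1) v unfolding d by (simp add: sum.distrib[symmetric])
    show ?thesis
    proof (cases "v \<in> A")
      case True
      have "{u \<in> V. {v, u} \<in> H} = {u \<in> V. f v u = 1}"
        using A_H[OF True] by blast
      then have "(\<Sum>u\<in>V. f v u) = int (vdegree H v)"
        using count[of "f v"] f01 v vdegree_neighbours[OF HE, of v] by simp
      then have "(\<Sum>u\<in>V. f v u - f u v) + z v - z v - b v = 2 * (int (vdegree H v) - g v)"
        using tot True by (simp add: b_def sum_subtractf)
      \<comment> \<open>The demand involves twice the degree in \<open>H\<close>, so a congruence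
        modulo 10 yields the degree modulo 5.\<close>
      then have "2 * 5 dvd 2 * (int (vdegree H v) - g v)" using f(2)[OF v] by (simp only:)
      then obtain c where "2 * (int (vdegree H v) - g v) = 2 * 5 * c" by (rule dvdE)
      then have "int (vdegree H v) = g v + 5 * c" by simp
      then show ?thesis by simp
    next
      case False
      then have vB: "v \<in> B" using v AB by auto
      have "{u \<in> V. {v, u} \<in> H} = {u \<in> V. f u v = 1}"
        using B_H[OF vB] by blast
      then have "(\<Sum>u\<in>V. f u v) = int (vdegree H v)"
        using count[of "\<lambda>u. f u v"] f01 v vdegree_neighbours[OF HE, of v] by simp
      then have "(\<Sum>u\<in>V. f v u - f u v) + z v - z v - b v = - (2 * (int (vdegree H v) - g v))"
        using tot bB[OF vB] by (simp add: sum_subtractf)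
      then have "2 * 5 dvd - (2 * (int (vdegree H v) - g v))" using f(2)[OF v] by (simp only:)
      then have "2 * 5 dvd 2 * (int (vdegree H v) - g v)" by (simp only: dvd_minus_iff)
      then obtain c where "2 * (int (vdegree H v) - g v) = 2 * 5 * c" by (rule dvdE)
      then have "int (vdegree H v) = g v + 5 * c" by simp
      then show ?thesis by simp
    qed
  qed
  then show ?thesis using that[OF HE] by blast
qed

section \<open>From the factor to a colouring with two colours\<close>

lemma irr_chromatic_index_le: "locally_irregular_colouring E k c \<Longrightarrow> irr_chromatic_index E \<le> enat k"
  unfolding irr_chromatic_index_def by (intro Inf_lower) blast

theorem theorem26:
  fixes V :: "'a set" and E :: "'a set set"
  assumes "finite_simple_graph V E"
    and "bipartite V E"
    and "edge_connected 16 V E"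
  shows "irr_chromatic_index E \<le> 2"
proof -
  interpret finite_simple_graph V E by (rule assms(1))
  have "\<exists>c. locally_irregular_colouring E 2 c"
  \<comment> \<open>Only an edge guarantees that \<open>A\<close> is large enough for the free
    choices; the edgeless graph is coloured trivially.\<close>
  proof (cases "E = {}")
    case True
    then show ?thesis unfolding locally_irregular_colouring_def locally_irregular_def
      by (intro exI[of _ "\<lambda>_. 0"]) simp
  next
    case False
    obtain A B where AB: "A \<union> B = V" "A \<inter> B = {}" and "\<forall>e\<in>E. \<exists>a\<in>A. \<exists>b\<in>B. e = {a, b}"
      using assms(2) unfolding bipartite_def by (elim exE conjE)
    then have bip: "\<exists>a\<in>A. \<exists>b\<in>B. e = {a, b}" if "e \<in> E" for e using that by (elim bspec)
    have fAB: "finite A" "finite B" using AB finite_verts by auto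
    define d where "d v = int (vdegree E v)" for v
    \<comment> \<open>The cut around \<open>{b}\<close> gives a vertex \<open>b\<close> of
      \<open>B\<close> at least 16 neighbours, all of them in \<open>A\<close>.\<close>
    have cA: "16 \<le> card A"
    proof -
      obtain a b where ab: "a \<in> A" "b \<in> B" using False bip by blast
      then have "{b} \<noteq> V" "{b} \<subseteq> V" using AB by auto
      then have "16 \<le> (\<Sum>v\<in>V - {b}. adj b v)" using edge_cut_ge[OF assms(3), of "{b}"] by simp
      also have "\<dots> \<le> (\<Sum>v\<in>V - {b}. of_bool (v \<in> A))"
      proof (intro sum_mono)
        fix v show "adj b v \<le> of_bool (v \<in> A)"
          using bip[of "{b, v}"] ab AB by (auto simp: adj_def doubleton_eq_iff)
      qed
      also have "\<dots> = int (card {v \<in> V - {b}. v \<in> A})"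
        using finite_verts by (intro sum_of_bool_card) simp
      also have "\<dots> \<le> int (card A)" using fAB by (auto intro!: card_mono)
      finally show ?thesis by simp
    qed
    obtain r where r: "4 \<le> card {a \<in> A. (d a - r) mod 5 = 0}"
      using pigeonhole_mod_5[OF fAB(1) cA] by blast
    \<comment> \<open>This is the imbalance of the degree sums when every free vertex receives 0.
      Giving 1 to \<open>(- S) mod 5\<close> of them, at most four, corrects it modulo 5.\<close>
    define S where "S = (\<Sum>v\<in>A. residue_A ((d v - r) mod 5) False) - (\<Sum>v\<in>B. residue_B ((d v - r) mod 5))"
    have "nat ((- S) mod 5) \<le> 4" by (simp add: nat_le_iff)
    then obtain W where W: "W \<subseteq> {a \<in> A. (d a - r) mod 5 = 0}" "card W = nat ((- S) mod 5)"
      using r by (meson le_trans obtain_subset_with_card_n)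
    define g where "g v = (if v \<in> A then residue_A ((d v - r) mod 5) (v \<in> W) else residue_B ((d v - r) mod 5))" for v
    have "sum g B = (\<Sum>v\<in>B. residue_B ((d v - r) mod 5))"
      using AB(2) by (intro sum.cong) (auto simp: g_def)
    moreover have "sum g A = (\<Sum>v\<in>A. residue_A ((d v - r) mod 5) False) + (- S) mod 5"
    proof -
      have "sum g A = (\<Sum>v\<in>A. residue_A ((d v - r) mod 5) False + of_bool (v \<in> W))"
        using W(1) by (intro sum.cong) (auto simp: g_def residue_A_def)
      also have "\<dots> = (\<Sum>v\<in>A. residue_A ((d v - r) mod 5) False) + int (card {v \<in> A. v \<in> W})"
        by (simp only: sum.distrib sum_of_bool_card[OF fAB(1)])
      also have "{v \<in> A. v \<in> W} = W" using W(1) by auto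
      finally show ?thesis using W(2) by simp
    qed
    ultimately have "sum g A - sum g B = S + (- S) mod 5" unfolding S_def by simp
    then have bal: "5 dvd sum g A - sum g B" by (simp add: dvd_eq_mod_eq_0 mod_simps)
    have "edge_connected 13 V E" using assms(3) unfolding edge_connected_def by simp
    then obtain H where H: "H \<subseteq> E" "\<And>v. v \<in> V \<Longrightarrow> int (vdegree H v) mod 5 = g v mod 5"
      using factor_mod_5[OF AB bip _ bal] by blast
    have HA: "int (vdegree H v) mod 5 \<in> {0, 1} \<and> (d v - int (vdegree H v) - r) mod 5 \<in> {0, 2, 4}"
      if "v \<in> A" for v
      using H(2)[of v] that AB(1) by (intro residue_A[where w = "v \<in> W"]) (auto simp: g_def)
    have HB: "int (vdegree H v) mod 5 \<in> {2, 3, 4} \<and> (d v - int (vdegree H v) - r) mod 5 \<in> {1, 3}"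
      if "v \<in> B" for v
      using H(2)[of v] that AB by (intro residue_B) (auto simp: g_def)
    have compl: "int (vdegree (E - H) v) = d v - int (vdegree H v)" for v
    proof -
      have "{e \<in> E. v \<in> e} = {e \<in> E - H. v \<in> e} \<union> {e \<in> H. v \<in> e}" using H(1) by auto
      moreover have "finite H" using H(1) finite_edges finite_subset by blast
      ultimately have "vdegree E v = vdegree (E - H) v + vdegree H v"
        unfolding vdegree_def using finite_edges by (simp add: card_Un_disjoint disjoint_iff)
      then show ?thesis unfolding d_def by simp
    qed
    \<comment> \<open>Every edge joins \<open>A\<close> to \<open>B\<close>, so only degrees across
      the classes need comparing, and for both parts they already differ modulo 5.\<close>
    have irr: "locally_irregular E'"
      if "E' \<subseteq> E" "\<And>a b. a \<in> A \<Longrightarrow> b \<in> B \<Longrightarrow> vdegree E' a \<noteq> vdegree E' b" for E'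
      unfolding locally_irregular_def
    proof (intro allI impI)
      fix u v assume "{u, v} \<in> E'"
      then have "{u, v} \<in> E" using that(1) by (rule set_mp[rotated])
      from bip[OF this] obtain a b where ab: "a \<in> A" "b \<in> B" "{u, v} = {a, b}" by (elim bexE)
      have "u = a \<and> v = b \<or> u = b \<and> v = a" using ab(3) by (simp only: doubleton_eq_iff)
      then show "vdegree E' u \<noteq> vdegree E' v" using that(2)[OF ab(1,2)] by (elim disjE conjE) simp_all
    qed
    have "locally_irregular H"
    proof (rule irr[OF H(1)])
      fix a b assume "a \<in> A" "b \<in> B"
      then show "vdegree H a \<noteq> vdegree H b" using HA[of a] HB[of b] by auto
    qed
    moreover have "locally_irregular (E - H)"
    proof (rule irr)
      fix a b assume ab: "a \<in> A" "b \<in> B"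
      then show "vdegree (E - H) a \<noteq> vdegree (E - H) b"
        using HA[of a] HB[of b] compl[of a] compl[of b] by auto
    qed simp
    moreover have "{e \<in> E. (if e \<in> H then 0 else 1::nat) = 0} = H" "{e \<in> E. (if e \<in> H then 0 else 1::nat) = 1} = E - H"
      using H(1) by auto
    ultimately have "locally_irregular_colouring E 2 (\<lambda>e. if e \<in> H then 0 else 1)"
      unfolding locally_irregular_colouring_def by (auto simp: less_2_cases_iff)
    then show ?thesis by blast
  qed
  then show ?thesis using irr_chromatic_index_le by (metis numeral_eq_enat)
qed

end
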